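(* Every positive integer $n$ is properly $K$-congruent over some real cubic field $K$. More precisely, for a square-free positive integer $n$ let $\lambda=\lambda(n)$ be the unique real solution of the cubic equation $$32\lambda^3-32\lambda^2+8\lambda+n^2=0.$$ Then the point $P_\lambda=(x_\lambda,y_\lambda)$ with coordinates $$x_\lambda=\frac{1}{4(n^2-16)^2}\Bigl\{256+992n^2+65n^4+(1024-2688n^2-28n^4)\lambda+(1024+1920n^2+4n^4)\lambda^2\Bigr\},$$ $$\begin{aligned}y_\lambda=\frac{1}{32(n^2-16)^3}\Bigl\{&-16384+72704n^2+80960n^4+2868n^6-n^8\\&+(196608-462848n^2-145152n^4-1456n^6)\lambda\\&+(196608+421888n^2+100608n^4+208n^6)\lambda^2\Bigr\}\end{aligned}$$ is a point of infinite order in the Mordell-Weil group $E_n(\mathbb{Q}(\lambda))$ of the elliptic curve $E_n: Y^2=X^3-n^2X$ over $\mathbb{Q}(\lambda)$.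
   Context: Let $K$ be a number field and let $n$ be a positive integer. We say that $n$ is a $K$-congruent number if there exist $a,b,c\in K$ such that $$a^2+b^2=c^2\qquad\text{and}\qquad \tfrac12 ab=n.$$ A $K$-congruent number $n$ is called properly $K$-congruent if this system has infinitely many solutions $(a,b,c)\in K^3$. A real cubic field here means a subfield of $\mathbb{R}$ of degree $3$ over $\mathbb{Q}$. *)

theory Defs
  imports
    Complex_Main
    "HOL-Algebra.Algebraic_Closure_Type"
    "HOL-Algebra.Generated_Fields"
    "HOL-Computational_Algebra.Squarefree"
begin

definition congruent_solutions :: "'a::field_char_0 set \<Rightarrow> nat \<Rightarrow> ('a \<times> 'a \<times> 'a) set" where
  "congruent_solutions K n =
     {(a, b, c). a \<in> K \<and> b \<in> K \<and> c \<in> K \<and> a\<^sup>2 + b\<^sup>2 = c\<^sup>2 \<and> 1 / 2 * a * b = of_nat n}"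

definition congruent_over :: "'a::field_char_0 set \<Rightarrow> nat \<Rightarrow> bool" where
  "congruent_over K n \<longleftrightarrow>
     (\<exists>a\<in>K. \<exists>b\<in>K. \<exists>c\<in>K. a\<^sup>2 + b\<^sup>2 = c\<^sup>2 \<and> 1 / 2 * a * b = of_nat n)"

definition properly_congruent_over :: "'a::field_char_0 set \<Rightarrow> nat \<Rightarrow> bool" where
  "properly_congruent_over K n \<longleftrightarrow>
     congruent_over K n \<and> infinite (congruent_solutions K n)"

abbreviation real_ring :: "real ring" where
  "real_ring \<equiv> ring_of_type_algebra"

definition real_cubic_field :: "real set \<Rightarrow> bool" where
  "real_cubic_field K \<longleftrightarrow> subfield K real_ring \<and> ring.dimension real_ring 3 \<rat> K"

(* Every subfield of the reals contains \<rat>, so this is \<rat>(l). *)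
definition rat_adjoin :: "real \<Rightarrow> real set" where
  "rat_adjoin l = generate_field real_ring {l}"

(* Points of Y^2 = X^3 + a X + b: None is the point at infinity. *)
type_synonym 'a ec_point = "('a \<times> 'a) option"

(* Chord-tangent law. The coefficient b does not enter the formulas. Two points of the
   curve with the same abscissa have equal or opposite ordinates, so once opposite points
   are excluded, x1 = x2 means doubling a point with y1 \<noteq> 0. *)
fun ec_add :: "'a::field \<Rightarrow> 'a ec_point \<Rightarrow> 'a ec_point \<Rightarrow> 'a ec_point" where
  "ec_add a None Q = Q"
| "ec_add a (Some P) None = Some P"
| "ec_add a (Some (x1, y1)) (Some (x2, y2)) =
     (if x1 = x2 \<and> y1 = - y2 then None
      else let m = (if x1 = x2 then (3 * x1\<^sup>2 + a) / (2 * y1) else (y2 - y1) / (x2 - x1));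
               x3 = m\<^sup>2 - x1 - x2
           in Some (x3, m * (x1 - x3) - y1))"

(* Written multiplicatively, as groups are in HOL-Algebra: the multiple m P is P [^] m. *)
definition ec_group :: "'a::field set \<Rightarrow> 'a \<Rightarrow> 'a \<Rightarrow> 'a ec_point monoid" where
  "ec_group K a b =
     \<lparr>carrier = insert None {Some (x, y) | x y. x \<in> K \<and> y \<in> K \<and> y\<^sup>2 = x ^ 3 + a * x + b},
      monoid.mult = ec_add a,
      one = None\<rparr>"

definition congruent_curve :: "nat \<Rightarrow> 'a::field set \<Rightarrow> 'a ec_point monoid" where
  "congruent_curve n K = ec_group K (- (of_nat n)\<^sup>2) 0"

definition infinite_order_in :: "('a, 'b) monoid_scheme \<Rightarrow> 'a \<Rightarrow> bool" where
  "infinite_order_in G P \<longleftrightarrow>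
     P \<in> carrier G \<and> (\<forall>m::nat. m > 0 \<longrightarrow> P [^]\<^bsub>G\<^esub> m \<noteq> \<one>\<^bsub>G\<^esub>)"

definition cubic_root :: "nat \<Rightarrow> real \<Rightarrow> bool" where
  "cubic_root n l \<longleftrightarrow> 32 * l ^ 3 - 32 * l\<^sup>2 + 8 * l + (real n)\<^sup>2 = 0"

definition x_coord :: "real \<Rightarrow> real \<Rightarrow> real" where
  "x_coord n l = 1 / (4 * (n ^ 2 - 16) ^ 2) *
     (256 + 992 * n ^ 2 + 65 * n ^ 4
      + (1024 - 2688 * n ^ 2 - 28 * n ^ 4) * l
      + (1024 + 1920 * n ^ 2 + 4 * n ^ 4) * l ^ 2)"

definition y_coord :: "real \<Rightarrow> real \<Rightarrow> real" where
  "y_coord n l = 1 / (32 * (n ^ 2 - 16) ^ 3) *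
     (- 16384 + 72704 * n ^ 2 + 80960 * n ^ 4 + 2868 * n ^ 6 - n ^ 8
      + (196608 - 462848 * n ^ 2 - 145152 * n ^ 4 - 1456 * n ^ 6) * l
      + (196608 + 421888 * n ^ 2 + 100608 * n ^ 4 + 208 * n ^ 6) * l ^ 2)"

end

theory Submission
  imports Defs
begin

text \<open>
  Put \<open>t = n / (2 (1 - 2 \<lambda>))\<close>. Then \<open>t\<^sup>2 = - 2 \<lambda>\<close> and \<open>n = 2 t (1 + t\<^sup>2)\<close>, so that
  \<open>Q = (- 4 t\<^sup>2, 4 t\<^sup>2 (1 - t\<^sup>2))\<close> lies on \<open>E\<^sub>n\<close>, and \<open>P\<^sub>\<lambda> = 2 Q\<close>. Since \<open>4\<close> does not divide \<open>n\<close>, a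
  parity argument shows that \<open>t\<close> is irrational and that the abscissa of \<open>P\<^sub>\<lambda>\<close> is larger than \<open>n\<close> at
  a prime above 2 (totally ramified if \<open>n\<close> is odd, inert if \<open>n\<close> is even). In that region
  \<open>x(2 P) = (x\<^sup>2 + n\<^sup>2)\<^sup>2 / (4 x (x\<^sup>2 - n\<^sup>2))\<close> has exactly the dyadic size of \<open>x / 4\<close>, so the points
  \<open>2\<^sup>k P\<^sub>\<lambda>\<close> are pairwise distinct; this gives infinitely many triangles. If a multiple of
  \<open>P\<^sub>\<lambda>\<close> vanished, its multiples would be periodic, contradicting distinctness.

  The identity \<open>2\<^sup>k P = 2 (\<dots> (2 P))\<close> needs associativity only on the identity component of
  \<open>E\<^sub>n(\<real>)\<close>. As \<open>P\<^sub>\<lambda>\<close> is a double, \<open>x\<close>, \<open>x - n\<close> and \<open>x + n\<close> are squares, and these points are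
  parametrised by the Jacobi functions sn, cn, dn of modulus \<open>1 / sqrt 2\<close>, whose addition law has no
  exceptional cases over the reals.
\<close>

section \<open>Real cubic fields\<close>

lemma real_ring_simps [simp]:
  "carrier real_ring = UNIV" "x \<otimes>\<^bsub>real_ring\<^esub> y = x * y" "x \<oplus>\<^bsub>real_ring\<^esub> y = x + y"
  "\<one>\<^bsub>real_ring\<^esub> = 1" "\<zero>\<^bsub>real_ring\<^esub> = 0"
  by (simp_all add: ring_of_type_algebra_def)

lemma field_real_ring: "field real_ring"
  by (rule field_from_type_algebra)

interpretation real_ring: cring real_ring
  by (rule cring_from_type_algebra)

lemma real_ring_a_inv [simp]: "\<ominus>\<^bsub>real_ring\<^esub> x = - x"
  using real_ring.minus_equality[of "- x" x] by simp

lemma real_ring_m_inv: "x \<noteq> 0 \<Longrightarrow> inv\<^bsub>real_ring\<^esub> x = inverse x"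
  using real_ring.comm_inv_char[of x "inverse x"] by simp

lemma subfield_real_ringI:
  assumes "1 \<in> K" "\<And>x. x \<in> K \<Longrightarrow> - x \<in> K" "\<And>x y. x \<in> K \<Longrightarrow> y \<in> K \<Longrightarrow> x + y \<in> K"
    "\<And>x y. x \<in> K \<Longrightarrow> y \<in> K \<Longrightarrow> x * y \<in> K" "\<And>x. x \<in> K \<Longrightarrow> x \<noteq> 0 \<Longrightarrow> inverse x \<in> K"
  shows "subfield K real_ring"
proof (rule field.subfieldI'[OF field_real_ring])
  show "subring K real_ring"
    by (rule real_ring.subringI) (use assms in auto)
qed (use assms in \<open>auto simp: real_ring_m_inv\<close>)

lemma subfield_real_ringD:
  assumes "subfield K real_ring"
  shows "1 \<in> K" "x \<in> K \<Longrightarrow> - x \<in> K" "x \<in> K \<Longrightarrow> y \<in> K \<Longrightarrow> x + y \<in> K"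
    "x \<in> K \<Longrightarrow> y \<in> K \<Longrightarrow> x - y \<in> K" "x \<in> K \<Longrightarrow> y \<in> K \<Longrightarrow> x * y \<in> K" "x \<in> K \<Longrightarrow> y \<in> K \<Longrightarrow> x / y \<in> K"
    "x \<in> K \<Longrightarrow> x ^ k \<in> K" "\<rat> \<subseteq> K"
proof -
  note E = subringE[OF subfieldE(1)[OF assms], simplified]
  have one: "1 \<in> K" and zero: "0 \<in> K"
    and neg: "x \<in> K \<Longrightarrow> - x \<in> K" and add: "x \<in> K \<Longrightarrow> y \<in> K \<Longrightarrow> x + y \<in> K"
    and mult: "x \<in> K \<Longrightarrow> y \<in> K \<Longrightarrow> x * y \<in> K" for x y
    using E by auto
  have diff: "x \<in> K \<Longrightarrow> y \<in> K \<Longrightarrow> x - y \<in> K" for x y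
    using add[of x "- y"] neg[of y] by simp
  \<comment> \<open>Since \<open>inverse 0 = 0\<close>, closure under inverse and division holds
    without a side condition.\<close>
  have inverse: "x \<in> K \<Longrightarrow> inverse x \<in> K" for x
  proof (cases "x = 0")
    case False
    assume "x \<in> K"
    then show ?thesis
      using real_ring.subfield_m_inv(1)[OF assms, of x] False by (simp add: real_ring_m_inv)
  qed (simp add: zero)
  have divide: "x \<in> K \<Longrightarrow> y \<in> K \<Longrightarrow> x / y \<in> K" for x y
    using mult[of x "inverse y"] inverse[of y] by (simp add: divide_inverse)
  have nat: "of_nat k \<in> K" for k
    by (induction k) (use zero one add in auto)
  have int: "of_int i \<in> K" for i
    using nat neg by (cases i rule: int_cases2) auto
  show "1 \<in> K" "x \<in> K \<Longrightarrow> - x \<in> K" "x \<in> K \<Longrightarrow> y \<in> K \<Longrightarrow> x + y \<in> K"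
    "x \<in> K \<Longrightarrow> y \<in> K \<Longrightarrow> x - y \<in> K" "x \<in> K \<Longrightarrow> y \<in> K \<Longrightarrow> x * y \<in> K" "x \<in> K \<Longrightarrow> y \<in> K \<Longrightarrow> x / y \<in> K"
    by (fact one neg add diff mult divide)+
  show "x \<in> K \<Longrightarrow> x ^ k \<in> K"
    by (induction k) (use one mult in auto)
  show "\<rat> \<subseteq> K"
    by (auto elim!: Rats_cases' intro: divide int)
qed

section \<open>The field generated by a root of an irreducible cubic\<close>

text \<open>The coefficient set is a parameter because both the field (\<open>A = \<rat>\<close>)
  and, in the dyadic argument, an order in it (\<open>A = \<int>\<close>) occur.\<close>

definition quadratic_span :: "real set \<Rightarrow> real \<Rightarrow> real set" where
  "quadratic_span A \<alpha> = {a + b * \<alpha> + c * \<alpha>\<^sup>2 | a b c. a \<in> A \<and> b \<in> A \<and> c \<in> A}"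

text \<open>In degree 3 the absence of rational roots is the same as irreducibility over
  \<open>\<rat>\<close>; it is what makes 1, \<alpha> and \<open>\<alpha>\<^sup>2\<close> a basis of
  the field.\<close>

locale irreducible_cubic =
  fixes \<alpha> p q r :: real
  assumes coeffs: "p \<in> \<rat>" "q \<in> \<rat>" "r \<in> \<rat>"
    and root: "\<alpha> ^ 3 = p * \<alpha>\<^sup>2 + q * \<alpha> + r"
    and no_rational_root: "s \<in> \<rat> \<Longrightarrow> s ^ 3 \<noteq> p * s\<^sup>2 + q * s + r"
begin

lemma irrational: "\<alpha> \<notin> \<rat>"
  using root no_rational_root by blast

lemma linear_independent2:
  assumes "a \<in> \<rat>" "b \<in> \<rat>" "a + b * \<alpha> = 0"
  shows "a = 0 \<and> b = 0"
proof (cases "b = 0")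
  case False
  then have "\<alpha> = - a / b" using assms(3) by (simp add: field_simps)
  then show ?thesis using assms(1,2) irrational by auto
qed (use assms in auto)

text \<open>Euclidean division of the cubic by \<open>X^2 + u X + v\<close>: the quotient is
  \<open>X - s\<close> and, up to sign, the remainder is \<open>g + e X\<close>. A zero remainder
  would make \<open>s\<close> a rational root. Independence and inverses are reduced to the linear
  case in this way.\<close>

lemma quadratic_remainder:
  assumes "u \<in> \<rat>" "v \<in> \<rat>"
  obtains s e g where "s \<in> \<rat>" "e \<in> \<rat>" "g \<in> \<rat>" "(v + u * \<alpha> + \<alpha>\<^sup>2) * (\<alpha> - s) = g + e * \<alpha>"
    "e \<noteq> 0 \<or> g \<noteq> 0"
proof
  define s e g where seg: "s = p + u" "e = q + v - s * u" "g = r - s * v"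
  show Q: "s \<in> \<rat>" "e \<in> \<rat>" "g \<in> \<rat>" using assms coeffs by (auto simp: seg)
  show "(v + u * \<alpha> + \<alpha>\<^sup>2) * (\<alpha> - s) = g + e * \<alpha>"
    using root unfolding seg by Groebner_Basis.algebra
  show "e \<noteq> 0 \<or> g \<noteq> 0"
  proof (rule ccontr)
    assume "\<not> (e \<noteq> 0 \<or> g \<noteq> 0)"
    then have "s ^ 3 = p * s\<^sup>2 + q * s + r"
      unfolding seg by Groebner_Basis.algebra
    then show False using no_rational_root Q by blast
  qed
qed

lemma linear_independent3:
  assumes abc: "a \<in> \<rat>" "b \<in> \<rat>" "c \<in> \<rat>" and eq: "a + b * \<alpha> + c * \<alpha>\<^sup>2 = 0"
  shows "a = 0 \<and> b = 0 \<and> c = 0"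
proof (cases "c = 0")
  case True
  then show ?thesis using linear_independent2[of a b] assms by simp
next
  case False
  obtain s e g where *: "s \<in> \<rat>" "e \<in> \<rat>" "g \<in> \<rat>"
    "(a / c + b / c * \<alpha> + \<alpha>\<^sup>2) * (\<alpha> - s) = g + e * \<alpha>" "e \<noteq> 0 \<or> g \<noteq> 0"
    using quadratic_remainder[of "b / c" "a / c"] abc by (metis Rats_divide)
  have "a / c + b / c * \<alpha> + \<alpha>\<^sup>2 = 0" using eq False by (simp add: field_simps)
  then show ?thesis using * linear_independent2[of g e] by auto
qed

lemma quadratic_span_unique:
  assumes "a \<in> \<rat>" "b \<in> \<rat>" "c \<in> \<rat>" "a' \<in> \<rat>" "b' \<in> \<rat>" "c' \<in> \<rat>"
    and "a + b * \<alpha> + c * \<alpha>\<^sup>2 = a' + b' * \<alpha> + c' * \<alpha>\<^sup>2"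
  shows "a = a' \<and> b = b' \<and> c = c'"
  using linear_independent3[of "a - a'" "b - b'" "c - c'"] assms by (auto simp: algebra_simps)

lemma quadratic_span_mult:
  "(a + b * \<alpha> + c * \<alpha>\<^sup>2) * (a' + b' * \<alpha> + c' * \<alpha>\<^sup>2) =
    (a * a' + r * (b * c' + c * b') + p * r * (c * c')) +
    (a * b' + b * a' + q * (b * c' + c * b') + (p * q + r) * (c * c')) * \<alpha> +
    (a * c' + b * b' + c * a' + p * (b * c' + c * b') + (p\<^sup>2 + q) * (c * c')) * \<alpha>\<^sup>2"
  using root by Groebner_Basis.algebra

abbreviation "K \<equiv> quadratic_span \<rat> \<alpha>"

lemma quadratic_spanI: "a \<in> \<rat> \<Longrightarrow> b \<in> \<rat> \<Longrightarrow> c \<in> \<rat> \<Longrightarrow> a + b * \<alpha> + c * \<alpha>\<^sup>2 \<in> K"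
  by (auto simp: quadratic_span_def)

lemma K_mult: "x \<in> K \<Longrightarrow> y \<in> K \<Longrightarrow> x * y \<in> K"
proof -
  assume "x \<in> K" "y \<in> K"
  then obtain a b c a' b' c' where Q: "a \<in> \<rat>" "b \<in> \<rat>" "c \<in> \<rat>" "a' \<in> \<rat>" "b' \<in> \<rat>" "c' \<in> \<rat>"
    and xy: "x = a + b * \<alpha> + c * \<alpha>\<^sup>2" "y = a' + b' * \<alpha> + c' * \<alpha>\<^sup>2"
    unfolding quadratic_span_def by blast
  show ?thesis
    unfolding xy quadratic_span_mult
    by (intro quadratic_spanI Rats_add Rats_mult Rats_power coeffs Q)
qed

lemma K_rat: "a \<in> \<rat> \<Longrightarrow> a \<in> K"
  using quadratic_spanI[of a 0 0] by simp

text \<open>Let \<open>f\<close> be the monic cubic with root \<alpha>, and \<beta> the zero of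
  \<open>a + b X\<close>. Then \<open>G\<close> is the quotient of \<open>f(X) - f(\<beta>)\<close>
  by \<open>X - \<beta>\<close>, evaluated at \<alpha>. As \<open>f(\<alpha>) = 0\<close>, the
  product \<open>(\<alpha> - \<beta>) * G\<close> is \<open>- f(\<beta>)\<close>, a nonzero
  rational.\<close>

lemma K_inverse_linear:
  assumes "a \<in> \<rat>" "b \<in> \<rat>" "a \<noteq> 0 \<or> b \<noteq> 0"
  shows "inverse (a + b * \<alpha>) \<in> K"
proof (cases "b = 0")
  case True
  then show ?thesis using K_rat assms by simp
next
  case False
  define \<beta> where "\<beta> = - a / b"
  define F where "F = \<beta> ^ 3 - p * \<beta>\<^sup>2 - q * \<beta> - r"
  have \<beta>: "\<beta> \<in> \<rat>" using assms by (simp add: \<beta>_def)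
  have F: "F \<noteq> 0" "F \<in> \<rat>" using no_rational_root[OF \<beta>] \<beta> coeffs by (auto simp: F_def)
  define G where "G = (\<beta>\<^sup>2 - p * \<beta> - q) + (\<beta> - p) * \<alpha> + 1 * \<alpha>\<^sup>2"
  have G: "G \<in> K" unfolding G_def by (intro quadratic_spanI) (use \<beta> coeffs in auto)
  have GF: "(\<alpha> - \<beta>) * G = - F"
    unfolding G_def F_def using root by Groebner_Basis.algebra
  have "a + b * \<alpha> = b * (\<alpha> - \<beta>)" using False by (simp add: \<beta>_def distrib_left)
  then have "(a + b * \<alpha>) * (- 1 / (b * F) * G) = - ((\<alpha> - \<beta>) * G) / F"
    using False by simp
  also have "\<dots> = 1"
    unfolding GF using F by simp
  finally have "inverse (a + b * \<alpha>) = - 1 / (b * F) * G" by (rule inverse_unique)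
  moreover have "- 1 / (b * F) \<in> \<rat>" using assms F by simp
  ultimately show ?thesis using G K_rat K_mult by metis
qed

lemma K_inverse:
  assumes "x \<in> K" "x \<noteq> 0"
  shows "inverse x \<in> K"
proof -
  obtain a b c where abc: "a \<in> \<rat>" "b \<in> \<rat>" "c \<in> \<rat>" and x: "x = a + b * \<alpha> + c * \<alpha>\<^sup>2"
    using assms by (auto simp: quadratic_span_def)
  show ?thesis
  proof (cases "c = 0")
    case True
    then have "a \<noteq> 0 \<or> b \<noteq> 0" "x = a + b * \<alpha>" using assms(2) x by auto
    then show ?thesis using K_inverse_linear[of a b] abc by metis
  next
    case False
    obtain s e g where *: "s \<in> \<rat>" "e \<in> \<rat>" "g \<in> \<rat>"
      "(a / c + b / c * \<alpha> + \<alpha>\<^sup>2) * (\<alpha> - s) = g + e * \<alpha>" "e \<noteq> 0 \<or> g \<noteq> 0"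
      using quadratic_remainder[of "b / c" "a / c"] abc by (metis Rats_divide)
    have ne: "g + e * \<alpha> \<noteq> 0" using linear_independent2[of g e] * by auto
    \<comment> \<open>Multiplying by the quotient \<open>\<alpha> - s\<close> of the division leaves
      a linear expression in \<alpha>, inverted by \<open>K_inverse_linear\<close>.\<close>
    have "x * (\<alpha> - s) = c * (g + e * \<alpha>)"
      using *(4) False by (simp add: x field_simps)
    then have "x * (inverse c * ((- s + 1 * \<alpha> + 0 * \<alpha>\<^sup>2) * inverse (g + e * \<alpha>))) = 1"
      using ne False by (simp add: divide_simps)
    then have "inverse x = inverse c * ((- s + 1 * \<alpha> + 0 * \<alpha>\<^sup>2) * inverse (g + e * \<alpha>))"
      by (rule inverse_unique)
    moreover have "inverse c \<in> K" using abc K_rat by simp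
    moreover have "- s + 1 * \<alpha> + 0 * \<alpha>\<^sup>2 \<in> K" by (intro quadratic_spanI) (use * in auto)
    moreover have "inverse (g + e * \<alpha>) \<in> K" using K_inverse_linear[of g e] * by blast
    ultimately show ?thesis using K_mult by metis
  qed
qed

lemma K_subfield: "subfield K real_ring"
proof (rule subfield_real_ringI)
  show "1 \<in> K" by (simp add: K_rat)
next
  fix x assume "x \<in> K"
  then obtain a b c where abc: "a \<in> \<rat>" "b \<in> \<rat>" "c \<in> \<rat>" and x: "x = a + b * \<alpha> + c * \<alpha>\<^sup>2"
    by (auto simp: quadratic_span_def)
  then show "- x \<in> K" using quadratic_spanI[of "- a" "- b" "- c"] by (simp add: algebra_simps)
  fix y assume "y \<in> K"
  then obtain a' b' c' where abc': "a' \<in> \<rat>" "b' \<in> \<rat>" "c' \<in> \<rat>" and y: "y = a' + b' * \<alpha> + c' * \<alpha>\<^sup>2"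
    by (auto simp: quadratic_span_def)
  have "x + y = (a + a') + (b + b') * \<alpha> + (c + c') * \<alpha>\<^sup>2"
    by (simp add: x y algebra_simps)
  then show "x + y \<in> K" using quadratic_spanI[of "a + a'" "b + b'" "c + c'"] abc abc' by simp
qed (auto intro: K_mult K_inverse)

lemma K_generated: "rat_adjoin \<alpha> = K"
  unfolding rat_adjoin_def
proof (rule field.generate_fieldI[OF field_real_ring, symmetric])
  show "{\<alpha>} \<subseteq> K" using quadratic_spanI[of 0 1 0] by simp
  fix L assume L: "subfield L real_ring" "{\<alpha>} \<subseteq> L"
  note LD = subfield_real_ringD[OF L(1)]
  show "K \<subseteq> L"
  proof
    fix x assume "x \<in> K"
    then obtain a b c where "a \<in> \<rat>" "b \<in> \<rat>" "c \<in> \<rat>" and x: "x = a + b * \<alpha> + c * \<alpha>\<^sup>2"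
      by (auto simp: quadratic_span_def)
    then have "a \<in> L" "b \<in> L" "c \<in> L" "\<alpha> \<in> L" using LD(8) L(2) by auto
    then show "x \<in> L" unfolding x by (intro LD(3,5,7))
  qed
qed (use K_subfield in auto)

text \<open>Dimension is defined inductively by line extensions, so 1, \<alpha> and
  \<open>\<alpha>\<^sup>2\<close> are adjoined one after the other, each lying outside the span of
  its predecessors.\<close>

lemma K_dimension: "ring.dimension real_ring 3 \<rat> K"
proof -
  let ?E1 = "real_ring.line_extension \<rat> 1 {0}"
  let ?E2 = "real_ring.line_extension \<rat> \<alpha> ?E1"
  have E1: "?E1 = \<rat>"
    by (auto simp: real_ring.line_extension_mem_iff)
  have E2: "x \<in> ?E2 \<longleftrightarrow> (\<exists>b\<in>\<rat>. \<exists>a\<in>\<rat>. x = b * \<alpha> + a)" for x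
    by (auto simp: real_ring.line_extension_mem_iff E1)
  have "\<alpha>\<^sup>2 \<notin> ?E2"
  proof
    assume "\<alpha>\<^sup>2 \<in> ?E2"
    then obtain a b where "a \<in> \<rat>" "b \<in> \<rat>" "\<alpha>\<^sup>2 = b * \<alpha> + a" by (auto simp: E2)
    then show False using linear_independent3[of "- a" "- b" 1] by simp
  qed
  then have "real_ring.dimension (Suc (Suc (Suc 0))) \<rat> (real_ring.line_extension \<rat> (\<alpha>\<^sup>2) ?E2)"
    using irrational E1 by (intro real_ring.Suc_dim) (simp_all add: real_ring.zero_dim[simplified])
  moreover have "real_ring.line_extension \<rat> (\<alpha>\<^sup>2) ?E2 = K"
  proof (intro Set.set_eqI iffI)
    fix x assume "x \<in> real_ring.line_extension \<rat> (\<alpha>\<^sup>2) ?E2"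
    then obtain c b a where "c \<in> \<rat>" "b \<in> \<rat>" "a \<in> \<rat>" "x = c * \<alpha>\<^sup>2 + (b * \<alpha> + a)"
      unfolding real_ring.line_extension_mem_iff[of _ _ "\<alpha>\<^sup>2"] by (auto simp: E2)
    then show "x \<in> K" using quadratic_spanI[of a b c] by (simp add: algebra_simps)
  next
    fix x assume "x \<in> K"
    then obtain a b c where abc: "a \<in> \<rat>" "b \<in> \<rat>" "c \<in> \<rat>" and x: "x = a + b * \<alpha> + c * \<alpha>\<^sup>2"
      by (auto simp: quadratic_span_def)
    have "b * \<alpha> + a \<in> ?E2" using abc by (auto simp: E2)
    moreover have "x = c \<otimes>\<^bsub>real_ring\<^esub> \<alpha>\<^sup>2 \<oplus>\<^bsub>real_ring\<^esub> (b * \<alpha> + a)" by (simp add: x)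
    ultimately show "x \<in> real_ring.line_extension \<rat> (\<alpha>\<^sup>2) ?E2"
      unfolding real_ring.line_extension_mem_iff[of _ _ "\<alpha>\<^sup>2"] using abc(3) by blast
  qed
  ultimately show ?thesis by (simp add: eval_nat_numeral)
qed

lemma rat_adjoin_cubic: "real_cubic_field (rat_adjoin \<alpha>)"
  unfolding real_cubic_field_def K_generated using K_subfield K_dimension by blast

end

section \<open>The group law via the Jacobi parametrisation\<close>

text \<open>The points \<open>(s, c, d)\<close> are \<open>(sn u / sqrt 2, cn u, dn u)\<close> for the modulus \<open>k\<^sup>2 = 1 / 2\<close>; the rescaling of
  \<open>sn\<close> keeps all coefficients integral.\<close>

definition jacobi_curve :: "(real \<times> real \<times> real) set" where
  "jacobi_curve = {(s, c, d). c\<^sup>2 = 1 - 2 * s\<^sup>2 \<and> d\<^sup>2 = 1 - s\<^sup>2}"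

text \<open>The addition theorem for sn, cn, dn in the rescaled coordinates; \<open>D\<close> is
  \<open>1 - k^2 sn^2 u sn^2 v\<close>.\<close>

fun jacobi_add :: "real \<times> real \<times> real \<Rightarrow> real \<times> real \<times> real \<Rightarrow> real \<times> real \<times> real" where
  "jacobi_add (s1, c1, d1) (s2, c2, d2) =
     (let D = 1 - 2 * s1\<^sup>2 * s2\<^sup>2
      in ((s1 * c2 * d2 + s2 * c1 * d1) / D,
          (c1 * c2 - 2 * s1 * s2 * d1 * d2) / D,
          (d1 * d2 - s1 * s2 * c1 * c2) / D))"

text \<open>Over the reals \<open>c^2 >= 0\<close> bounds each \<open>s^2\<close> by 1/2, so
  \<open>2 * s1\<^sup>2 * s2\<^sup>2\<close> is at most 1/2. This is why the addition law has no
  exceptional pairs.\<close>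

lemma jacobi_denom_pos:
  fixes s1 s2 :: real
  assumes "c1\<^sup>2 = 1 - 2 * s1\<^sup>2" "c2\<^sup>2 = 1 - 2 * s2\<^sup>2"
  shows "1 - 2 * s1\<^sup>2 * s2\<^sup>2 > 0"
proof -
  have "2 * s1\<^sup>2 \<le> 1" "2 * s2\<^sup>2 \<le> 1"
    using assms zero_le_power2[of c1] zero_le_power2[of c2] by linarith+
  then have "(2 * s1\<^sup>2) * s2\<^sup>2 \<le> 1 * s2\<^sup>2"
    by (intro mult_right_mono) auto
  then show ?thesis
    using \<open>2 * s2\<^sup>2 \<le> 1\<close> by simp
qed

lemma jacobi_add_closed:
  assumes "p \<in> jacobi_curve" "q \<in> jacobi_curve"
  shows "jacobi_add p q \<in> jacobi_curve"
proof -
  obtain s1 c1 d1 s2 c2 d2 where pq: "p = (s1, c1, d1)" "q = (s2, c2, d2)"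
    by (metis prod.exhaust)
  have e: "c1\<^sup>2 = 1 - 2 * s1\<^sup>2" "d1\<^sup>2 = 1 - s1\<^sup>2" "c2\<^sup>2 = 1 - 2 * s2\<^sup>2" "d2\<^sup>2 = 1 - s2\<^sup>2"
    using assms by (auto simp: pq jacobi_curve_def)
  define D where "D = 1 - 2 * s1\<^sup>2 * s2\<^sup>2"
  have D: "D \<noteq> 0"
    using jacobi_denom_pos[OF e(1,3)] by (simp add: D_def)
  have "(c1 * c2 - 2 * s1 * s2 * d1 * d2)\<^sup>2 = D\<^sup>2 - 2 * (s1 * c2 * d2 + s2 * c1 * d1)\<^sup>2"
    "(d1 * d2 - s1 * s2 * c1 * c2)\<^sup>2 = D\<^sup>2 - (s1 * c2 * d2 + s2 * c1 * d1)\<^sup>2"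
    unfolding D_def using e by Groebner_Basis.algebra+
  then show ?thesis
    using D by (simp add: pq jacobi_curve_def Let_def flip: D_def) (simp add: power_divide field_simps)
qed

text \<open>Each side is brought to one denominator, \<open>M\<close> or \<open>M'\<close>, which is
  nonzero by \<open>jacobi_denom_pos\<close> since the partial sums lie on the curve again.
  Cross-multiplication leaves three polynomial identities modulo the curve equations.\<close>

lemma jacobi_add_assoc:
  assumes "p \<in> jacobi_curve" "q \<in> jacobi_curve" "u \<in> jacobi_curve"
  shows "jacobi_add (jacobi_add p q) u = jacobi_add p (jacobi_add q u)"
proof -
  obtain s1 c1 d1 s2 c2 d2 s3 c3 d3
    where pq: "p = (s1, c1, d1)" "q = (s2, c2, d2)" "u = (s3, c3, d3)"
    by (metis prod.exhaust)
  have e: "c1\<^sup>2 = 1 - 2 * s1\<^sup>2" "d1\<^sup>2 = 1 - s1\<^sup>2" "c2\<^sup>2 = 1 - 2 * s2\<^sup>2" "d2\<^sup>2 = 1 - s2\<^sup>2"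
    "c3\<^sup>2 = 1 - 2 * s3\<^sup>2" "d3\<^sup>2 = 1 - s3\<^sup>2"
    using assms by (auto simp: pq jacobi_curve_def)
  define S C E D where SCED: "S = s1 * c2 * d2 + s2 * c1 * d1"
    "C = c1 * c2 - 2 * s1 * s2 * d1 * d2"
    "E = d1 * d2 - s1 * s2 * c1 * c2" "D = 1 - 2 * s1\<^sup>2 * s2\<^sup>2"
  define S' C' E' D' where SCED': "S' = s2 * c3 * d3 + s3 * c2 * d2"
    "C' = c2 * c3 - 2 * s2 * s3 * d2 * d3"
    "E' = d2 * d3 - s2 * s3 * c2 * c3" "D' = 1 - 2 * s2\<^sup>2 * s3\<^sup>2"
  define M where "M = D\<^sup>2 - 2 * S\<^sup>2 * s3\<^sup>2"
  define M' where "M' = D'\<^sup>2 - 2 * s1\<^sup>2 * S'\<^sup>2"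
  have D: "D \<noteq> 0" "D' \<noteq> 0"
    using jacobi_denom_pos[OF e(1,3)] jacobi_denom_pos[OF e(3,5)] by (simp_all add: SCED SCED')
  have "(S / D, C / D, E / D) \<in> jacobi_curve" "(S' / D', C' / D', E' / D') \<in> jacobi_curve"
    using jacobi_add_closed[OF assms(1,2)] jacobi_add_closed[OF assms(2,3)]
    by (simp_all add: pq Let_def flip: SCED SCED')
  then have "1 - 2 * (S / D)\<^sup>2 * s3\<^sup>2 > 0" "1 - 2 * s1\<^sup>2 * (S' / D')\<^sup>2 > 0"
    using e jacobi_denom_pos[of _ _ c3 s3] jacobi_denom_pos[of c1 s1] by (auto simp: jacobi_curve_def)
  moreover have M1: "1 - 2 * (S / D)\<^sup>2 * s3\<^sup>2 = M / D\<^sup>2" and M2: "1 - 2 * s1\<^sup>2 * (S' / D')\<^sup>2 = M' / D'\<^sup>2"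
    using D by (simp_all add: M_def M'_def field_simps)
  ultimately have M: "M \<noteq> 0" "M' \<noteq> 0" by auto
  have l: "jacobi_add (jacobi_add p q) u =
      ((S * D * c3 * d3 + s3 * C * E) / M, (C * D * c3 - 2 * S * s3 * E * d3) / M,
       (E * D * d3 - S * s3 * C * c3) / M)"
    using D(1) by (simp add: pq Let_def M1 flip: SCED) (simp add: diff_divide_eq_iff add_divide_eq_iff power2_eq_square ac_simps)
  have r: "jacobi_add p (jacobi_add q u) =
      ((s1 * C' * E' + S' * D' * c1 * d1) / M', (C' * D' * c1 - 2 * S' * s1 * E' * d1) / M',
       (E' * D' * d1 - S' * s1 * C' * c1) / M')"
    using D(2) by (simp add: pq Let_def M2 flip: SCED') (simp add: diff_divide_eq_iff add_divide_eq_iff power2_eq_square ac_simps)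
  have "(S * D * c3 * d3 + s3 * C * E) * M' = (s1 * C' * E' + S' * D' * c1 * d1) * M"
    unfolding M_def M'_def SCED SCED' using e by Groebner_Basis.algebra
  moreover have "(C * D * c3 - 2 * S * s3 * E * d3) * M' = (C' * D' * c1 - 2 * S' * s1 * E' * d1) * M"
    unfolding M_def M'_def SCED SCED' using e by Groebner_Basis.algebra
  moreover have "(E * D * d3 - S * s3 * C * c3) * M' = (E' * D' * d1 - S' * s1 * C' * c1) * M"
    unfolding M_def M'_def SCED SCED' using e by Groebner_Basis.algebra
  ultimately show ?thesis
    unfolding l r using M by (simp add: frac_eq_eq)
qed

text \<open>A parametrisation of the identity component of \<open>y\<^sup>2 = x\<^sup>3 - r\<^sup>4 x\<close>, on which \<open>x = r\<^sup>2 d\<^sup>2 / s\<^sup>2\<close>,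
  \<open>x - r\<^sup>2 = r\<^sup>2 c\<^sup>2 / s\<^sup>2\<close> and \<open>x + r\<^sup>2 = r\<^sup>2 / s\<^sup>2\<close> are squares.\<close>

fun jacobi_to_ec :: "real \<Rightarrow> real \<times> real \<times> real \<Rightarrow> real ec_point" where
  "jacobi_to_ec r (s, c, d) =
     (if s = 0 then None else Some (r\<^sup>2 * (1 / s\<^sup>2 - 1), r ^ 3 * (c * d) / s ^ 3))"

lemma jacobi_add_commute: "jacobi_add p q = jacobi_add q p"
  by (cases p; cases q) (simp add: Let_def algebra_simps)

text \<open>The points over infinity are \<open>(0, c1, d1)\<close> with \<open>c1\<close> and
  \<open>d1\<close> equal to 1 or -1. Adding one multiplies \<open>s\<close>, \<open>c\<close>,
  \<open>d\<close> by \<open>c1 * d1\<close>, \<open>c1\<close>, \<open>d1\<close>, and these signs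
  cancel in both coordinates of the image.\<close>

lemma jacobi_to_ec_add_zero:
  assumes "(0, c1, d1) \<in> jacobi_curve" "q \<in> jacobi_curve"
  shows "jacobi_to_ec r (jacobi_add (0, c1, d1) q) = jacobi_to_ec r q"
proof -
  have "c1 = 1 \<or> c1 = -1" "d1 = 1 \<or> d1 = -1"
    using assms(1) by (auto simp: jacobi_curve_def power2_eq_1_iff)
  then show ?thesis
    by (cases q) auto
qed

text \<open>The conjugate \<open>T\<close> of the numerator \<open>S\<close> satisfies
  \<open>S * T = \<Delta> * D\<close>, hence \<open>D / S = T / \<Delta>\<close>. So the image of
  the sum can be written over \<Delta>, the quantity that also divides the chord slope, and the two
  sides become comparable.\<close>

lemma jacobi_to_ec_add_chord:
  assumes e: "c1\<^sup>2 = 1 - 2 * s1\<^sup>2" "d1\<^sup>2 = 1 - s1\<^sup>2" "c2\<^sup>2 = 1 - 2 * s2\<^sup>2" "d2\<^sup>2 = 1 - s2\<^sup>2"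
    and s: "s1 \<noteq> 0" "s2 \<noteq> 0" "s1\<^sup>2 \<noteq> s2\<^sup>2" and r: "r \<noteq> 0"
  shows "jacobi_to_ec r (jacobi_add (s1, c1, d1) (s2, c2, d2)) =
    ec_add a (jacobi_to_ec r (s1, c1, d1)) (jacobi_to_ec r (s2, c2, d2))"
proof -
  define S C E D where SCED: "S = s1 * c2 * d2 + s2 * c1 * d1"
    "C = c1 * c2 - 2 * s1 * s2 * d1 * d2"
    "E = d1 * d2 - s1 * s2 * c1 * c2" "D = 1 - 2 * s1\<^sup>2 * s2\<^sup>2"
  define T where "T = s1 * c2 * d2 - s2 * c1 * d1"
  define \<Delta> where "\<Delta> = s1\<^sup>2 - s2\<^sup>2"
  \<comment> \<open>Chosen so that \<open>C * E * T\<^sup>2 = D\<^sup>2 * V\<close>, which removes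
    \<open>D\<close> from the ordinate as well.\<close>
  define V where "V = (s1 * c1 * d2 - s2 * c2 * d1) * (s1 * d1 * c2 - s2 * d2 * c1)"
  define w1 w2 where w: "w1 = c1 * d1" "w2 = c2 * d2"
  \<comment> \<open>The slope of the chord divided by \<open>r\<close>.\<close>
  define \<mu> where "\<mu> = (w2 * s1 ^ 3 - w1 * s2 ^ 3) / (s1 * s2 * \<Delta>)"
  have D: "D \<noteq> 0" using jacobi_denom_pos[OF e(1,3)] by (simp add: SCED)
  have \<Delta>: "\<Delta> \<noteq> 0" using s by (simp add: \<Delta>_def)
  have ST: "S * T = \<Delta> * D"
  proof -
    have "S * T = s1\<^sup>2 * (c2\<^sup>2 * d2\<^sup>2) - s2\<^sup>2 * (c1\<^sup>2 * d1\<^sup>2)"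
      unfolding SCED T_def by Groebner_Basis.algebra
    also have "\<dots> = \<Delta> * D"
      unfolding e SCED \<Delta>_def by Groebner_Basis.algebra
    finally show ?thesis .
  qed
  then have ST0: "S \<noteq> 0" "T \<noteq> 0" using D \<Delta> by auto
  have CE: "C * E * T\<^sup>2 = D\<^sup>2 * V"
    unfolding SCED T_def V_def using e by Groebner_Basis.algebra
  have ds: "D / S = T / \<Delta>" using ST ST0 \<Delta> by (simp add: field_simps)
  have inv2: "1 / (S / D)\<^sup>2 = T\<^sup>2 / \<Delta>\<^sup>2"
    using ds by (metis divide_divide_eq_right mult_1 power_divide power_one)
  have ceq: "C / D * (E / D) = V / T\<^sup>2" using CE D ST0 by (simp add: field_simps power2_eq_square)
  have "C / D * (E / D) / (S / D) ^ 3 = C / D * (E / D) * (D / S) ^ 3"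
    by (simp add: power_divide)
  also have "\<dots> = V * T / \<Delta> ^ 3"
    unfolding ceq ds using ST0 \<Delta> by (simp add: field_simps power2_eq_square power3_eq_cube)
  finally have yeq: "C / D * (E / D) / (S / D) ^ 3 = V * T / \<Delta> ^ 3" .
  have lhs: "jacobi_to_ec r (jacobi_add (s1, c1, d1) (s2, c2, d2)) =
      Some (r\<^sup>2 * (T\<^sup>2 / \<Delta>\<^sup>2 - 1), r ^ 3 * (V * T / \<Delta> ^ 3))"
  proof -
    have "jacobi_to_ec r (jacobi_add (s1, c1, d1) (s2, c2, d2)) =
        Some (r\<^sup>2 * (1 / (S / D)\<^sup>2 - 1), r ^ 3 * (C / D * (E / D) / (S / D) ^ 3))"
      using D ST0 by (simp add: Let_def flip: SCED)
    then show ?thesis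
      unfolding inv2 yeq .
  qed
  have xne: "r\<^sup>2 * (1 / s1\<^sup>2 - 1) \<noteq> r\<^sup>2 * (1 / s2\<^sup>2 - 1)"
    using r s by (simp add: field_simps)
  have m: "(r ^ 3 * w2 / s2 ^ 3 - r ^ 3 * w1 / s1 ^ 3) / (r\<^sup>2 * (1 / s2\<^sup>2 - 1) - r\<^sup>2 * (1 / s1\<^sup>2 - 1)) = r * \<mu>"
  proof -
    have "r ^ 3 * w2 / s2 ^ 3 - r ^ 3 * w1 / s1 ^ 3 = r ^ 3 * (w2 * s1 ^ 3 - w1 * s2 ^ 3) / (s1 ^ 3 * s2 ^ 3)"
      using s by (simp add: field_simps)
    moreover have "r\<^sup>2 * (1 / s2\<^sup>2 - 1) - r\<^sup>2 * (1 / s1\<^sup>2 - 1) = r\<^sup>2 * \<Delta> / (s1\<^sup>2 * s2\<^sup>2)"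
      using s by (simp add: \<Delta>_def field_simps)
    ultimately show ?thesis
      using s r \<Delta> by (simp add: \<mu>_def power2_eq_square power3_eq_cube)
  qed
  have "(w2 * s1 ^ 3 - w1 * s2 ^ 3)\<^sup>2 =
      (s1\<^sup>2 + s2\<^sup>2) * \<Delta>\<^sup>2 - 3 * s1\<^sup>2 * s2\<^sup>2 * \<Delta>\<^sup>2 + T\<^sup>2 * s1\<^sup>2 * s2\<^sup>2"
    unfolding T_def \<Delta>_def w using e by Groebner_Basis.algebra
  then have x3: "\<mu>\<^sup>2 - (1 / s1\<^sup>2 - 1) - (1 / s2\<^sup>2 - 1) = T\<^sup>2 / \<Delta>\<^sup>2 - 1"
    using s \<Delta> by (simp add: \<mu>_def power_divide power_mult_distrib) (simp add: field_simps power2_eq_square)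
  have "(w2 * s1 ^ 3 - w1 * s2 ^ 3) * (\<Delta>\<^sup>2 - s1\<^sup>2 * T\<^sup>2) - w1 * s2 * \<Delta> ^ 3 = V * T * s1 ^ 3 * s2"
    unfolding T_def \<Delta>_def V_def w using e by Groebner_Basis.algebra
  then have y3: "\<mu> * (1 / s1\<^sup>2 - T\<^sup>2 / \<Delta>\<^sup>2) - w1 / s1 ^ 3 = V * T / \<Delta> ^ 3"
    using s \<Delta> by (simp add: \<mu>_def field_simps power2_eq_square power3_eq_cube)
  have X: "(r * \<mu>)\<^sup>2 - r\<^sup>2 * (1 / s1\<^sup>2 - 1) - r\<^sup>2 * (1 / s2\<^sup>2 - 1) = r\<^sup>2 * (T\<^sup>2 / \<Delta>\<^sup>2 - 1)"
    by (simp only: flip: x3) (simp add: algebra_simps power_mult_distrib)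
  have Y: "r * \<mu> * (r\<^sup>2 * (1 / s1\<^sup>2 - 1) - r\<^sup>2 * (T\<^sup>2 / \<Delta>\<^sup>2 - 1)) - r ^ 3 * w1 / s1 ^ 3 = r ^ 3 * (V * T / \<Delta> ^ 3)"
    by (simp only: flip: y3) (simp add: algebra_simps power2_eq_square power3_eq_cube)
  show ?thesis
    unfolding lhs using s(1,2) xne
    by (simp only: jacobi_to_ec.simps ec_add.simps if_False simp_thms Let_def m X Y flip: w)
qed

lemma jacobi_to_ec_add:
  assumes p: "p \<in> jacobi_curve" and q: "q \<in> jacobi_curve" and r: "r \<noteq> 0"
  shows "jacobi_to_ec r (jacobi_add p q) = ec_add (- (r\<^sup>2)\<^sup>2) (jacobi_to_ec r p) (jacobi_to_ec r q)"
proof -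
  obtain s1 c1 d1 s2 c2 d2 where pq: "p = (s1, c1, d1)" "q = (s2, c2, d2)"
    by (metis prod.exhaust)
  have e: "c1\<^sup>2 = 1 - 2 * s1\<^sup>2" "d1\<^sup>2 = 1 - s1\<^sup>2" "c2\<^sup>2 = 1 - 2 * s2\<^sup>2" "d2\<^sup>2 = 1 - s2\<^sup>2"
    using p q by (auto simp: pq jacobi_curve_def)
  consider "s1 = 0" | "s2 = 0" | "s1 \<noteq> 0" "s2 \<noteq> 0" "s1\<^sup>2 \<noteq> s2\<^sup>2"
    | "s1 \<noteq> 0" "s2 \<noteq> 0" "s1\<^sup>2 = s2\<^sup>2" by blast
  then show ?thesis
  proof cases
    case 1
    then show ?thesis
      using jacobi_to_ec_add_zero[of c1 d1 q r] p q by (simp add: pq)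
  next
    case 2
    then show ?thesis
      using jacobi_to_ec_add_zero[of c2 d2 p r] p q jacobi_add_commute[of p q]
      by (cases "jacobi_to_ec r p") (simp_all add: pq del: jacobi_add.simps)
  next
    case 3
    then show ?thesis
      using jacobi_to_ec_add_chord[OF e 3 r] by (simp add: pq)
  next
    case 4
    define w where "w = c1 * d1"
    define D where "D = 1 - 2 * s1\<^sup>2 * s2\<^sup>2"
    have D: "D \<noteq> 0" using jacobi_denom_pos[OF e(1,3)] by (simp add: D_def)
    have x: "r\<^sup>2 * (1 / s1\<^sup>2 - 1) = r\<^sup>2 * (1 / s2\<^sup>2 - 1)" using 4 by simp
    have s23: "s2 ^ 3 = s1\<^sup>2 * s2" "s1 ^ 3 = s1\<^sup>2 * s1" using 4 by (simp_all add: power2_eq_square power3_eq_cube)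
    \<comment> \<open>For equal abscissas, opposite ordinates mean that the first coordinate of the
      Jacobi sum vanishes, so both sides give infinity together.\<close>
    have yiff: "r ^ 3 * (c1 * d1) / s1 ^ 3 = - (r ^ 3 * (c2 * d2) / s2 ^ 3) \<longleftrightarrow> s1 * c2 * d2 + s2 * c1 * d1 = 0"
    proof -
      have "r ^ 3 * (c1 * d1) / s1 ^ 3 + r ^ 3 * (c2 * d2) / s2 ^ 3 =
          r ^ 3 * (s1 * c2 * d2 + s2 * c1 * d1) / (s1\<^sup>2 * s1 * s2)"
        using 4 unfolding s23 by (simp add: field_simps)
      then show ?thesis
        using 4 r by (simp add: eq_neg_iff_add_eq_0)
    qed
    show ?thesis
    proof (cases "s1 * c2 * d2 + s2 * c1 * d1 = 0")
      case True
      then show ?thesis using 4 x yiff by (simp add: pq Let_def)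
    next
      case False
      \<comment> \<open>A difference of squares that vanishes because
        \<open>s1\<^sup>2 = s2\<^sup>2\<close>. With the first factor nonzero the second is zero:
        the ordinates agree and the tangent rule applies.\<close>
      have "(s1 * c2 * d2 + s2 * c1 * d1) * (s1 * c2 * d2 - s2 * c1 * d1) = 0"
        using e 4(3) by Groebner_Basis.algebra
      then have eqw: "s1 * (c2 * d2) = s2 * w" using False by (simp add: w_def mult.assoc)
      have w0: "w \<noteq> 0" using False eqw by (auto simp: w_def mult.assoc)
      have w2: "w\<^sup>2 = (1 - 2 * s1\<^sup>2) * (1 - s1\<^sup>2)" using e by (simp add: w_def power_mult_distrib)
      have De: "D = 1 - 2 * s1 ^ 4" using 4 by (simp add: D_def power4_eq_xxxx power2_eq_square)
      have S: "s1 * c2 * d2 + s2 * c1 * d1 = 2 * s2 * w" using eqw by (simp add: w_def mult.assoc)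
      define \<mu> where "\<mu> = (3 * (1 - s1\<^sup>2)\<^sup>2 - s1 ^ 4) / (2 * s1 * w)"
      have m: "(3 * (r\<^sup>2 * (1 / s1\<^sup>2 - 1))\<^sup>2 + - (r\<^sup>2)\<^sup>2) / (2 * (r ^ 3 * (c1 * d1) / s1 ^ 3)) = r * \<mu>"
      proof -
        have "3 * (r\<^sup>2 * (1 / s1\<^sup>2 - 1))\<^sup>2 + - (r\<^sup>2)\<^sup>2 = r ^ 4 * (3 * (1 - s1\<^sup>2)\<^sup>2 - s1 ^ 4) / s1 ^ 4"
          using 4(1) by (simp add: field_simps power2_eq_square power4_eq_xxxx)
        then show ?thesis
          using 4(1) r w0
          by (simp add: \<mu>_def flip: w_def) (simp add: field_simps power2_eq_square power3_eq_cube power4_eq_xxxx)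
      qed
      have "(3 * (1 - s1\<^sup>2)\<^sup>2 - s1 ^ 4)\<^sup>2 = 8 * w\<^sup>2 * (1 - s1\<^sup>2) + D\<^sup>2 - 4 * s1\<^sup>2 * w\<^sup>2"
        unfolding De w2 by Groebner_Basis.algebra
      then have x3: "\<mu>\<^sup>2 - (1 / s1\<^sup>2 - 1) - (1 / s2\<^sup>2 - 1) = D\<^sup>2 / (4 * s1\<^sup>2 * w\<^sup>2) - 1"
        using 4 w0 by (simp add: \<mu>_def power_divide power_mult_distrib) (simp add: field_simps power2_eq_square)
      define V where "V = (c1 * c2 - 2 * s1 * s2 * d1 * d2) * (d1 * d2 - s1 * s2 * c1 * c2)"
      have V: "s1 * V = s2 * (w\<^sup>2 * (1 + 2 * s1 ^ 4) - s1\<^sup>2 * ((1 - 2 * s1\<^sup>2)\<^sup>2 + 2 * (1 - s1\<^sup>2)\<^sup>2))"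
        unfolding V_def w_def using e 4(3) eqw unfolding w_def by Groebner_Basis.algebra
      have "(3 * (1 - s1\<^sup>2)\<^sup>2 - s1 ^ 4) * (4 * w\<^sup>2 - D\<^sup>2) - 8 * w ^ 4
        = (w\<^sup>2 * (1 + 2 * s1 ^ 4) - s1\<^sup>2 * ((1 - 2 * s1\<^sup>2)\<^sup>2 + 2 * (1 - s1\<^sup>2)\<^sup>2)) * D"
        unfolding De using w2 by Groebner_Basis.algebra
      then have Y0: "s1 * V * D = s2 * ((3 * (1 - s1\<^sup>2)\<^sup>2 - s1 ^ 4) * (4 * w\<^sup>2 - D\<^sup>2) - 8 * w ^ 4)"
        using V by simp
      have y3: "\<mu> * (1 / s1\<^sup>2 - D\<^sup>2 / (4 * s1\<^sup>2 * w\<^sup>2)) - w / s1 ^ 3 = V * D / (2 * s2 * w) ^ 3"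
      proof -
        have "\<mu> * (1 / s1\<^sup>2 - D\<^sup>2 / (4 * s1\<^sup>2 * w\<^sup>2)) - w / s1 ^ 3 =
            ((3 * (1 - s1\<^sup>2)\<^sup>2 - s1 ^ 4) * (4 * w\<^sup>2 - D\<^sup>2) - 8 * w ^ 4) / (8 * s1 ^ 3 * w ^ 3)"
          using 4 w0 by (simp add: \<mu>_def field_simps power2_eq_square power3_eq_cube power4_eq_xxxx)
        also have "\<dots> = s2 * ((3 * (1 - s1\<^sup>2)\<^sup>2 - s1 ^ 4) * (4 * w\<^sup>2 - D\<^sup>2) - 8 * w ^ 4) / (8 * s1 ^ 3 * s2 * w ^ 3)"
          using 4 by simp
        also have "\<dots> = V * D / (2 * s2 * w) ^ 3"
          unfolding Y0[symmetric] power_mult_distrib s23 using 4 w0 by (simp add: field_simps)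
        finally show ?thesis .
      qed
      have X: "(r * \<mu>)\<^sup>2 - r\<^sup>2 * (1 / s1\<^sup>2 - 1) - r\<^sup>2 * (1 / s2\<^sup>2 - 1) = r\<^sup>2 * (D\<^sup>2 / (4 * s1\<^sup>2 * w\<^sup>2) - 1)"
        by (simp only: flip: x3) (simp add: algebra_simps power_mult_distrib)
      have Y: "r * \<mu> * (r\<^sup>2 * (1 / s1\<^sup>2 - 1) - r\<^sup>2 * (D\<^sup>2 / (4 * s1\<^sup>2 * w\<^sup>2) - 1)) - r ^ 3 * (c1 * d1) / s1 ^ 3
          = r ^ 3 * (V * D / (2 * s2 * w) ^ 3)"
        by (simp only: flip: y3 w_def) (simp add: algebra_simps power2_eq_square power3_eq_cube)
      have "jacobi_to_ec r (jacobi_add p q) =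
          Some (r\<^sup>2 * (D\<^sup>2 / (4 * s1\<^sup>2 * w\<^sup>2) - 1), r ^ 3 * (V * D / (2 * s2 * w) ^ 3))"
        unfolding 4(3) using D 4(1,2) w0 by (simp add: pq Let_def S V_def flip: D_def)
          (simp add: power_divide power_mult_distrib power2_eq_square power3_eq_cube)
      moreover have "ec_add (- (r\<^sup>2)\<^sup>2) (jacobi_to_ec r p) (jacobi_to_ec r q) =
          Some (r\<^sup>2 * (D\<^sup>2 / (4 * s1\<^sup>2 * w\<^sup>2) - 1), r ^ 3 * (V * D / (2 * s2 * w) ^ 3))"
      proof -
        have "ec_add (- (r\<^sup>2)\<^sup>2) (jacobi_to_ec r p) (jacobi_to_ec r q) =
          (let m = r * \<mu>; x3 = m\<^sup>2 - r\<^sup>2 * (1 / s1\<^sup>2 - 1) - r\<^sup>2 * (1 / s2\<^sup>2 - 1)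
           in Some (x3, m * (r\<^sup>2 * (1 / s1\<^sup>2 - 1) - x3) - r ^ 3 * (c1 * d1) / s1 ^ 3))"
          unfolding m[symmetric] pq using 4(1,2) x yiff False by (simp only: jacobi_to_ec.simps ec_add.simps if_False simp_thms if_True)
        also have "\<dots> = Some (r\<^sup>2 * (D\<^sup>2 / (4 * s1\<^sup>2 * w\<^sup>2) - 1), r ^ 3 * (V * D / (2 * s2 * w) ^ 3))"
          unfolding Let_def X Y ..
        finally show ?thesis .
      qed
      ultimately show ?thesis by simp
    qed
  qed
qed

section \<open>Multiples of a point\<close>

text \<open>Associativity is available on the Jacobi side, so every multiple is written as the image
  of a repeated Jacobi sum \<open>f m\<close>, where multiples add as expected.\<close>

lemma jacobi_to_ec_power_add:
  fixes K :: "real set" and b :: real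
  assumes p: "p \<in> jacobi_curve" and r: "r \<noteq> 0"
  defines "G \<equiv> ec_group K (- (r\<^sup>2)\<^sup>2) b" and "P \<equiv> jacobi_to_ec r p"
  shows "P [^]\<^bsub>G\<^esub> (j + k) = ec_add (- (r\<^sup>2)\<^sup>2) (P [^]\<^bsub>G\<^esub> j) (P [^]\<^bsub>G\<^esub> (k::nat))"
proof -
  \<comment> \<open>The start \<open>(0, 1, 1)\<close> holds the values of sn, cn, dn at 0; the
    summand \<open>p\<close> stands on the right to match the recursion of
    \<open>[^]\<close>.\<close>
  define f where "f m = ((\<lambda>u. jacobi_add u p) ^^ m) (0, 1, 1)" for m :: nat
  have f_Suc: "f (Suc m) = jacobi_add (f m) p" for m by (simp add: f_def)
  have f_closed: "f m \<in> jacobi_curve" for m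
    by (induction m) (simp add: f_def jacobi_curve_def, simp add: f_Suc jacobi_add_closed p)
  have f_0: "jacobi_add u (f 0) = u" for u
    by (cases u) (simp add: f_def)
  have f_add: "f (j + k) = jacobi_add (f j) (f k)" for j k
    by (induction k) (simp_all only: f_0 add_0_right add_Suc_right f_Suc jacobi_add_assoc f_closed p)
  have "P [^]\<^bsub>G\<^esub> m = jacobi_to_ec r (f m)" for m :: nat
  proof (induction m)
    case 0
    show ?case by (simp add: G_def ec_group_def f_def nat_pow_def)
  next
    case (Suc m)
    have "P [^]\<^bsub>G\<^esub> Suc m = ec_add (- (r\<^sup>2)\<^sup>2) (P [^]\<^bsub>G\<^esub> m) P"
      by (simp add: G_def ec_group_def nat_pow_def)
    also have "\<dots> = jacobi_to_ec r (f (Suc m))"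
      unfolding Suc.IH f_Suc using jacobi_to_ec_add[OF f_closed p r] by (simp add: P_def)
    finally show ?case .
  qed
  then show ?thesis
    by (simp add: f_add jacobi_to_ec_add f_closed r)
qed

text \<open>If the \<open>m\<close>-th multiple were infinity, multiples would depend on the index
  modulo \<open>m\<close> only. But iterated doublings are the multiples with index
  \<open>2 ^ k\<close>, and these are infinitely many.\<close>

lemma power_ne_one_if_doublings_distinct:
  assumes p: "p \<in> jacobi_curve" and r: "r \<noteq> 0"
    and inj: "inj (\<lambda>k. ((\<lambda>Q. ec_add (- (r\<^sup>2)\<^sup>2) Q Q) ^^ k) (jacobi_to_ec r p))"
    and "m > 0"
  shows "jacobi_to_ec r p [^]\<^bsub>ec_group K (- (r\<^sup>2)\<^sup>2) b\<^esub> (m::nat) \<noteq> \<one>\<^bsub>ec_group K (- (r\<^sup>2)\<^sup>2) b\<^esub>"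
proof
  define g where "g i = jacobi_to_ec r p [^]\<^bsub>ec_group K (- (r\<^sup>2)\<^sup>2) b\<^esub> i" for i :: nat
  note g_add = jacobi_to_ec_power_add[OF p r, of K b, folded g_def]
  assume "jacobi_to_ec r p [^]\<^bsub>ec_group K (- (r\<^sup>2)\<^sup>2) b\<^esub> m = \<one>\<^bsub>ec_group K (- (r\<^sup>2)\<^sup>2) b\<^esub>"
  then have gm: "g m = None" by (simp add: g_def ec_group_def)
  have "g (k * m + i) = g i" for k i
    by (induction k) (simp_all add: add.assoc g_add gm)
  then have "g i = g (i mod m)" for i
    by (metis div_mult_mod_eq)
  then have "range g \<subseteq> g ` {..<m}"
    using \<open>m > 0\<close> by (metis image_eqI image_subsetI lessThan_iff mod_less_divisor)
  then have fin: "finite (range g)"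
    by (rule finite_subset) simp
  have "((\<lambda>Q. ec_add (- (r\<^sup>2)\<^sup>2) Q Q) ^^ k) (jacobi_to_ec r p) = g (2 ^ k)" for k
  proof (induction k)
    case 0
    show ?case by (simp add: g_def ec_group_def nat_pow_def)
  next
    case (Suc k)
    then show ?case by (simp add: mult_2 g_add)
  qed
  then have "range (\<lambda>k. ((\<lambda>Q. ec_add (- (r\<^sup>2)\<^sup>2) Q Q) ^^ k) (jacobi_to_ec r p)) \<subseteq> range g"
    by auto
  then show False
    using inj fin finite_subset range_inj_infinite by blast
qed

section \<open>Dyadic growth under doubling\<close>

lemma ec_double:
  fixes x y N :: real
  assumes curve: "y\<^sup>2 = x ^ 3 - N\<^sup>2 * x" and y: "y \<noteq> 0"
  obtains x' y' where "ec_add (- N\<^sup>2) (Some (x, y)) (Some (x, y)) = Some (x', y')"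
    "y'\<^sup>2 = x' ^ 3 - N\<^sup>2 * x'" "x' = (x\<^sup>2 + N\<^sup>2)\<^sup>2 / (4 * x * (x\<^sup>2 - N\<^sup>2))"
    "\<And>K. subfield K real_ring \<Longrightarrow> N \<in> K \<Longrightarrow> x \<in> K \<Longrightarrow> y \<in> K \<Longrightarrow> x' \<in> K \<and> y' \<in> K"
proof
  define m where "m = (3 * x\<^sup>2 + - N\<^sup>2) / (2 * y)"
  define x' where "x' = m\<^sup>2 - x - x"
  define y' where "y' = m * (x - x') - y"
  have m: "m * (2 * y) = 3 * x\<^sup>2 - N\<^sup>2" using y by (simp add: m_def)
  show "ec_add (- N\<^sup>2) (Some (x, y)) (Some (x, y)) = Some (x', y')"
    using y by (simp add: Let_def m_def x'_def y'_def)
  show "y'\<^sup>2 = x' ^ 3 - N\<^sup>2 * x'"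
    unfolding y'_def x'_def using m curve by Groebner_Basis.algebra
  have y2: "y\<^sup>2 = x * (x\<^sup>2 - N\<^sup>2)" unfolding curve by Groebner_Basis.algebra
  have "x' * (4 * y\<^sup>2) = (x\<^sup>2 + N\<^sup>2)\<^sup>2"
    unfolding x'_def using m curve by Groebner_Basis.algebra
  then have "x' = (x\<^sup>2 + N\<^sup>2)\<^sup>2 / (4 * y\<^sup>2)" using y by (simp add: field_simps)
  then show "x' = (x\<^sup>2 + N\<^sup>2)\<^sup>2 / (4 * x * (x\<^sup>2 - N\<^sup>2))" by (simp add: y2 mult.assoc)
  fix K assume K: "subfield K real_ring" "N \<in> K" "x \<in> K" "y \<in> K"
  note KD = subfield_real_ringD[OF K(1)]
  have "numeral k \<in> K" for k using KD(8) by auto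
  then have "m \<in> K" unfolding m_def by (intro KD(2-7) K)
  moreover from this have "x' \<in> K" unfolding x'_def by (intro KD(2-7) K)
  ultimately show "x' \<in> K \<and> y' \<in> K" unfolding y'_def using K by (auto intro!: KD(2-7))
qed

text \<open>Think of \<open>U\<close> as the complement in a ring \<open>R\<close> of a prime ideal above 2: the abscissas
  \<open>A / (2 E B)\<close> with \<open>A, B \<in> U\<close> below are dyadically larger than any \<open>N \<in> R\<close>, and doubling such a
  point multiplies \<open>E\<close> by 4.\<close>

locale dyadic_units =
  fixes R U :: "real set"
  assumes R_mult: "x \<in> R \<Longrightarrow> y \<in> R \<Longrightarrow> x * y \<in> R"
    and R_int: "of_int i \<in> R"
    and U_subset: "U \<subseteq> R"
    and U_mult: "x \<in> U \<Longrightarrow> y \<in> U \<Longrightarrow> x * y \<in> U"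
    and U_add: "x \<in> U \<Longrightarrow> y \<in> R \<Longrightarrow> x + 2 * y \<in> U"
    and two_not_U: "x \<in> R \<Longrightarrow> 2 * x \<notin> U"
begin

lemma U_nonzero: "x \<in> U \<Longrightarrow> x \<noteq> 0"
  using two_not_U[of 0] R_int[of 0] by auto

lemma U_power: "x \<in> U \<Longrightarrow> x ^ Suc k \<in> U"
  by (induction k) (auto intro: U_mult)

lemma R_power: "x \<in> R \<Longrightarrow> x ^ k \<in> R"
  by (induction k) (use R_int[of 1] in \<open>auto intro: R_mult\<close>)

text \<open>The element \<open>z\<close> is chosen with
  \<open>2 * z = (2 * E * B)\<^sup>2 * N\<^sup>2\<close>, so that
  \<open>x\<^sup>2 + N\<^sup>2\<close> and \<open>x\<^sup>2 - N\<^sup>2\<close> have numerators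
  congruent to \<open>A\<^sup>2\<close> modulo 2. These stay in \<open>U\<close>, and the
  duplication formula contributes the 4.\<close>

lemma double_level:
  assumes curve: "y\<^sup>2 = x ^ 3 - N\<^sup>2 * x" and AB: "A \<in> U" "B \<in> U" and x: "x = A / (2 * E * B)"
    and E: "E \<in> R" "E \<noteq> 0" and N: "N \<in> R"
  shows "y \<noteq> 0"
    and "\<exists>A'\<in>U. \<exists>B'\<in>U. (x\<^sup>2 + N\<^sup>2)\<^sup>2 / (4 * x * (x\<^sup>2 - N\<^sup>2)) = A' / (2 * (4 * E) * B')"
proof -
  define z where "z = 2 * (E\<^sup>2 * B\<^sup>2 * N\<^sup>2)"
  have "B \<in> R" using AB U_subset by blast
  then have z: "z \<in> R"
    unfolding z_def using E N R_int[of 2] by (auto intro!: R_mult R_power)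
  then have z': "(-1) * z \<in> R"
    using R_int[of "-1"] R_mult[of "-1" z] by simp
  have A2: "A\<^sup>2 \<in> U" using U_power[of A 1] AB by (simp add: numeral_2_eq_2)
  have plus: "A\<^sup>2 + 2 * z \<in> U" and minus: "A\<^sup>2 - 2 * z \<in> U"
    using U_add[OF A2 z] U_add[OF A2 z'] by simp_all
  have nz: "A \<noteq> 0" "B \<noteq> 0" "A\<^sup>2 - 2 * z \<noteq> 0" using AB minus U_nonzero by blast+
  have D: "2 * E * B \<noteq> 0" using E nz by simp
  have xp: "x\<^sup>2 + N\<^sup>2 = (A\<^sup>2 + 2 * z) / (2 * E * B)\<^sup>2" and xm: "x\<^sup>2 - N\<^sup>2 = (A\<^sup>2 - 2 * z) / (2 * E * B)\<^sup>2"
    unfolding x z_def using D by (simp_all add: field_simps)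
  have "y\<^sup>2 = x * (x\<^sup>2 - N\<^sup>2)" unfolding curve by Groebner_Basis.algebra
  also have "\<dots> \<noteq> 0" using nz D unfolding xm unfolding x by simp
  finally show "y \<noteq> 0" by auto
  have "(x\<^sup>2 + N\<^sup>2)\<^sup>2 / (4 * x * (x\<^sup>2 - N\<^sup>2)) = (A\<^sup>2 + 2 * z)\<^sup>2 / (2 * (4 * E) * (A * B * (A\<^sup>2 - 2 * z)))"
  proof -
    have "(p / d\<^sup>2)\<^sup>2 / (4 * (A / d) * (m / d\<^sup>2)) = p\<^sup>2 / (4 * d * (A * m))" if "d \<noteq> 0" for p d m :: real
      using that by (simp add: power2_eq_square)
    note eq = this[OF D]
    show ?thesis
      unfolding xp xm unfolding x eq by (simp add: mult_ac)
  qed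
  moreover have "(A\<^sup>2 + 2 * z)\<^sup>2 \<in> U" using U_power[OF plus, of 1] by (simp add: numeral_2_eq_2)
  moreover have "A * B * (A\<^sup>2 - 2 * z) \<in> U" using AB minus by (auto intro!: U_mult)
  ultimately show "\<exists>A'\<in>U. \<exists>B'\<in>U. (x\<^sup>2 + N\<^sup>2)\<^sup>2 / (4 * x * (x\<^sup>2 - N\<^sup>2)) = A' / (2 * (4 * E) * B')"
    by blast
qed

text \<open>The invariant is that the \<open>k\<close>-th doubling has abscissa
  \<open>A / (2 * (4 ^ k * E) * B)\<close> with \<open>A\<close> and \<open>B\<close> in
  \<open>U\<close>. It keeps ordinates nonzero, so that doubling can go on, and it separates the
  abscissas.\<close>

lemma doublings:
  assumes curve: "y\<^sup>2 = x ^ 3 - N\<^sup>2 * x" and AB: "A \<in> U" "B \<in> U" and x: "x = A / (2 * E * B)"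
    and E: "E \<in> R" "E \<noteq> 0" and N: "N \<in> R"
    and K: "subfield K real_ring" "N \<in> K" "x \<in> K" "y \<in> K"
  obtains f where "inj (fst \<circ> f)"
    "\<And>k. ((\<lambda>Q. ec_add (- N\<^sup>2) Q Q) ^^ k) (Some (x, y)) = Some (f k)"
    "\<And>k. fst (f k) \<in> K \<and> snd (f k) \<in> K \<and> snd (f k) \<noteq> 0 \<and> (snd (f k))\<^sup>2 = fst (f k) ^ 3 - N\<^sup>2 * fst (f k)"
proof -
  define P where "P k = ((\<lambda>Q. ec_add (- N\<^sup>2) Q Q) ^^ k) (Some (x, y))" for k
  have four: "4 ^ k * E \<in> R" for k :: nat
    using E R_int[of 4] by (auto intro!: R_mult R_power)
  have P: "\<exists>x y. P k = Some (x, y) \<and> x \<in> K \<and> y \<in> K \<and> y\<^sup>2 = x ^ 3 - N\<^sup>2 * x \<and>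
      (\<exists>A\<in>U. \<exists>B\<in>U. x = A / (2 * (4 ^ k * E) * B))" for k
  proof (induction k)
    case 0
    then show ?case using assms by (auto simp: P_def)
  next
    case (Suc k)
    then obtain x y A B where IH: "P k = Some (x, y)" "x \<in> K" "y \<in> K" "y\<^sup>2 = x ^ 3 - N\<^sup>2 * x"
      "A \<in> U" "B \<in> U" "x = A / (2 * (4 ^ k * E) * B)" by blast
    have E': "4 ^ k * E \<noteq> 0" using E by simp
    note level = double_level[OF IH(4-7) four E' N]
    obtain x' y' where 2: "ec_add (- N\<^sup>2) (Some (x, y)) (Some (x, y)) = Some (x', y')"
      "y'\<^sup>2 = x' ^ 3 - N\<^sup>2 * x'" "x' = (x\<^sup>2 + N\<^sup>2)\<^sup>2 / (4 * x * (x\<^sup>2 - N\<^sup>2))" "x' \<in> K \<and> y' \<in> K"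
      using ec_double[OF IH(4) level(1)] K IH(2,3) by metis
    have "P (Suc k) = Some (x', y')" using 2(1) IH(1) by (simp add: P_def)
    then show ?case using 2 level(2) by (auto simp: mult.assoc)
  qed
  define f where "f k = the (P k)" for k
  have f: "P k = Some (f k)" "fst (f k) \<in> K" "snd (f k) \<in> K" "(snd (f k))\<^sup>2 = fst (f k) ^ 3 - N\<^sup>2 * fst (f k)"
    "\<exists>A\<in>U. \<exists>B\<in>U. fst (f k) = A / (2 * (4 ^ k * E) * B)" for k
  proof -
    obtain x y where "P k = Some (x, y)" "x \<in> K" "y \<in> K" "y\<^sup>2 = x ^ 3 - N\<^sup>2 * x"
      "\<exists>A\<in>U. \<exists>B\<in>U. x = A / (2 * (4 ^ k * E) * B)"
      using P[of k] by (elim exE conjE)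
    then show "P k = Some (f k)" "fst (f k) \<in> K" "snd (f k) \<in> K"
      "(snd (f k))\<^sup>2 = fst (f k) ^ 3 - N\<^sup>2 * fst (f k)"
      "\<exists>A\<in>U. \<exists>B\<in>U. fst (f k) = A / (2 * (4 ^ k * E) * B)"
      by (simp_all add: f_def)
  qed
  show thesis
  proof
    show "((\<lambda>Q. ec_add (- N\<^sup>2) Q Q) ^^ k) (Some (x, y)) = Some (f k)" for k
      using f(1)[of k] by (simp add: P_def)
    have "snd (f k) \<noteq> 0" for k
      using f(5)[of k] double_level(1)[OF f(4)[of k] _ _ _ four[of k] _ N] E by auto
    then show "fst (f k) \<in> K \<and> snd (f k) \<in> K \<and> snd (f k) \<noteq> 0 \<and> (snd (f k))\<^sup>2 = fst (f k) ^ 3 - N\<^sup>2 * fst (f k)" for k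
      using f by blast
    have less: "fst (f j) \<noteq> fst (f k)" if "j < k" for j k
    proof
      assume eq: "fst (f j) = fst (f k)"
      obtain A B A' B' where U: "A \<in> U" "B \<in> U" "A' \<in> U" "B' \<in> U"
        and A: "fst (f j) = A / (2 * (4 ^ j * E) * B)" "fst (f k) = A' / (2 * (4 ^ k * E) * B')"
        using f(5)[of j] f(5)[of k] by blast
      obtain i where i: "k = j + Suc i" using \<open>j < k\<close> less_iff_Suc_add by auto
      have "A / (2 * (4 ^ j * E) * B) = A' / (2 * (4 ^ k * E) * B')" using eq A by simp
      \<comment> \<open>Cross-multiplying leaves the factor \<open>4 ^ Suc i\<close>. Splitting off
        one 2 shows an element of \<open>U\<close> as twice an element of \<open>R\<close>.\<close>
      then have "2 * (2 * 4 ^ i * A * B') = A' * B"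
        using E U_nonzero[OF U(2)] U_nonzero[OF U(4)] by (simp add: i power_add field_simps)
      moreover have "2 * 4 ^ i * A * B' \<in> R"
        using U U_subset R_int[of 2] R_int[of 4] by (auto intro!: R_mult R_power)
      ultimately show False using two_not_U U_mult[OF U(3,2)] by metis
    qed
    show "inj (fst \<circ> f)"
      by (rule injI) (metis less comp_apply nat_neq_iff)
  qed
qed

end

section \<open>A prime above 2\<close>

text \<open>Write \<open>t = a / b\<close> in lowest terms and clear denominators. For
  \<open>n = 2 * k\<close> with \<open>k\<close> odd, parity of \<open>a^3 + a b^2 = k b^3\<close>
  forces \<open>a\<close> and \<open>b\<close> both even. For odd \<open>n\<close> it forces
  \<open>b\<close> even, and then \<open>a\<close> even.\<close>

lemma no_rational_parameter:
  fixes t :: real and n :: nat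
  assumes t: "t \<in> \<rat>" and n: "\<not> 4 dvd n"
  shows "2 * t ^ 3 + 2 * t \<noteq> real n"
proof
  assume eq: "2 * t ^ 3 + 2 * t = real n"
  obtain a b where ab: "b > 0" "coprime a b" "t = of_int a / of_int b"
    using t by (metis Rats_cases')
  have "2 * real_of_int a ^ 3 + 2 * of_int a * of_int b ^ 2 = real n * of_int b ^ 3"
    using eq ab(1) by (simp add: ab(3) field_simps power2_eq_square power3_eq_cube)
  then have "real_of_int (2 * a ^ 3 + 2 * a * b ^ 2) = real_of_int (int n * b ^ 3)" by simp
  then have i: "2 * a ^ 3 + 2 * a * b ^ 2 = int n * b ^ 3" by (simp only: of_int_eq_iff)
  have cop: "\<not> (even a \<and> even b)" using ab(2) by (metis coprime_common_divisor odd_one)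
  show False
  proof (cases "even n")
    case True
    then obtain k where k: "n = 2 * k" by auto
    then have "odd k" using n by auto
    moreover have "a ^ 3 + a * b ^ 2 = int k * b ^ 3" using i by (simp add: k)
    then have "even (a ^ 3 + a * b ^ 2) = even (int k * b ^ 3)" by simp
    ultimately show False using cop by auto
  next
    case False
    have "even (int n * b ^ 3)" using i by (metis dvd_add dvd_triv_left mult.assoc)
    then have "even b" using False by simp
    then obtain c where c: "b = 2 * c" by auto
    have "2 * a ^ 3 = 2 * (2 * (2 * int n * c ^ 3 - 2 * a * c ^ 2))"
      using i unfolding c by (simp add: power_mult_distrib algebra_simps)
    then have "even (a ^ 3)" by (metis dvd_triv_left mult_left_cancel zero_neq_numeral)
    then show False using cop \<open>even b\<close> by simp
  qed
qed

text \<open>The predicate \<open>W\<close> singles out \<open>U\<close> through the integer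
  coordinates. The assumption \<open>mult\<close> is the multiplication table of
  \<open>quadratic_span_mult\<close>, and \<open>add\<close> says that only parities matter.
  Uniqueness of coordinates transfers \<open>two\<close> to real numbers.\<close>

lemma (in irreducible_cubic) dyadic_unitsI:
  fixes W :: "int \<Rightarrow> int \<Rightarrow> int \<Rightarrow> bool"
  assumes pqr: "p = of_int p'" "q = of_int q'" "r = of_int r'"
    and mult: "\<And>a b c a' b' c'. W a b c \<Longrightarrow> W a' b' c' \<Longrightarrow>
      W (a * a' + r' * (b * c' + c * b') + p' * r' * (c * c'))
        (a * b' + b * a' + q' * (b * c' + c * b') + (p' * q' + r') * (c * c'))
        (a * c' + b * b' + c * a' + p' * (b * c' + c * b') + (p'\<^sup>2 + q') * (c * c'))"
    and add: "\<And>a b c a' b' c'. W a b c \<Longrightarrow> W (a + 2 * a') (b + 2 * b') (c + 2 * c')"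
    and two: "\<And>a b c. \<not> W (2 * a) (2 * b) (2 * c)"
  shows "dyadic_units (quadratic_span \<int> \<alpha>) {of_int a + of_int b * \<alpha> + of_int c * \<alpha>\<^sup>2 | a b c. W a b c}"
    (is "dyadic_units ?R ?U")
proof
  have R: "x \<in> ?R \<longleftrightarrow> (\<exists>a b c. x = of_int a + of_int b * \<alpha> + of_int c * \<alpha>\<^sup>2)" for x
    unfolding quadratic_span_def by (auto elim!: Ints_cases) (metis Ints_of_int)
  have mult_eq: "(of_int a + of_int b * \<alpha> + of_int c * \<alpha>\<^sup>2) * (of_int a' + of_int b' * \<alpha> + of_int c' * \<alpha>\<^sup>2) =
      of_int (a * a' + r' * (b * c' + c * b') + p' * r' * (c * c')) +
      of_int (a * b' + b * a' + q' * (b * c' + c * b') + (p' * q' + r') * (c * c')) * \<alpha> +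
      of_int (a * c' + b * b' + c * a' + p' * (b * c' + c * b') + (p'\<^sup>2 + q') * (c * c')) * \<alpha>\<^sup>2"
    for a b c a' b' c'
    unfolding quadratic_span_mult by (simp add: pqr)
  show "x * y \<in> ?R" if "x \<in> ?R" "y \<in> ?R" for x y
    using that unfolding R by (metis mult_eq)
  show "x * y \<in> ?U" if "x \<in> ?U" "y \<in> ?U" for x y
    using that mult mult_eq by blast
  show "x + 2 * y \<in> ?U" if x: "x \<in> ?U" and y: "y \<in> ?R" for x y
  proof -
    obtain a b c a' b' c' where W: "W a b c" and xy: "x = of_int a + of_int b * \<alpha> + of_int c * \<alpha>\<^sup>2"
      "y = of_int a' + of_int b' * \<alpha> + of_int c' * \<alpha>\<^sup>2"
      using x y unfolding R by blast
    have "x + 2 * y = of_int (a + 2 * a') + of_int (b + 2 * b') * \<alpha> + of_int (c + 2 * c') * \<alpha>\<^sup>2"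
      unfolding xy by (simp add: algebra_simps)
    with add[OF W] show ?thesis by blast
  qed
  show "of_int i \<in> ?R" for i
    unfolding R by (rule exI[of _ i], rule exI[of _ 0], rule exI[of _ 0]) simp
  show "?U \<subseteq> ?R"
    using R by blast
  show "2 * x \<notin> ?U" if x: "x \<in> ?R" for x
  proof
    assume "2 * x \<in> ?U"
    then obtain a b c a' b' c' where W: "W a' b' c'" and eq:
      "2 * (of_int a + of_int b * \<alpha> + of_int c * \<alpha>\<^sup>2) = of_int a' + of_int b' * \<alpha> + of_int c' * \<alpha>\<^sup>2"
      using x unfolding R by blast
    have "real_of_int (2 * a) = of_int a' \<and> real_of_int (2 * b) = of_int b' \<and> real_of_int (2 * c) = of_int c'"
      by (rule quadratic_span_unique) (use eq in \<open>auto simp: algebra_simps\<close>)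
    then show False using W two by (metis of_int_eq_iff)
  qed
qed

lemma dyadic_level:
  fixes t :: real and n :: nat
  assumes n: "\<not> 4 dvd n" and t: "real n = 2 * t ^ 3 + 2 * t"
  obtains R U A B E where "dyadic_units R U" "A \<in> U" "B \<in> U" "E \<in> R" "E \<noteq> 0"
    "(t ^ 4 + 6 * t\<^sup>2 + 1)\<^sup>2 / (4 * (1 - t\<^sup>2)\<^sup>2) = A / (2 * E * B)"
proof (cases "even n")
  case True
  then obtain k where k: "n = 2 * k" by auto
  then have "odd k" using n by auto
  have t3: "t ^ 3 = real k - t" using t by (simp add: k)
  interpret irreducible_cubic t 0 "-1" "real k"
  proof
    show "t ^ 3 = 0 * t\<^sup>2 + -1 * t + real k" using t3 by simp
    fix s :: real assume "s \<in> \<rat>"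
    then show "s ^ 3 \<noteq> 0 * s\<^sup>2 + -1 * s + real k" using no_rational_parameter[OF _ n, of s] by (auto simp: k)
  qed auto
  \<comment> \<open>Modulo 2 the equation of \<open>t\<close> is \<open>X^3 + X + 1\<close>,
    irreducible over the field with two elements. The quotient by 2 is thus a field with 8 elements,
    and \<open>W\<close> means nonzero in it.\<close>
  define W :: "int \<Rightarrow> int \<Rightarrow> int \<Rightarrow> bool" where "W a b c \<longleftrightarrow> odd a \<or> odd b \<or> odd c" for a b c
  define U where "U = {of_int a + of_int b * t + of_int c * t\<^sup>2 | a b c. W a b c}"
  interpret dyadic_units "quadratic_span \<int> t" U
    unfolding U_def
  proof (rule dyadic_unitsI[where p' = 0 and q' = "-1" and r' = "int k"])
    fix a b c a' b' c' assume "W a b c" "W a' b' c'"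
    then show "W (a * a' + int k * (b * c' + c * b') + 0 * int k * (c * c'))
        (a * b' + b * a' + -1 * (b * c' + c * b') + (0 * -1 + int k) * (c * c'))
        (a * c' + b * b' + c * a' + 0 * (b * c' + c * b') + (0\<^sup>2 + -1) * (c * c'))"
      using \<open>odd k\<close> unfolding W_def by (cases "even a"; cases "even b"; cases "even c"; cases "even a'"; cases "even b'"; cases "even c'") simp_all
  qed (auto simp: W_def)
  have "t ^ 4 + 6 * t\<^sup>2 + 1 = of_int 1 + of_int (int k) * t + of_int 5 * t\<^sup>2"
    unfolding of_int_of_nat_eq of_int_1 of_int_numeral using t3 by Groebner_Basis.algebra
  moreover have "W 1 (int k) 5" by (simp add: W_def)
  ultimately have A: "t ^ 4 + 6 * t\<^sup>2 + 1 \<in> U" unfolding U_def by blast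
  have "1 - t\<^sup>2 = of_int 1 + of_int 0 * t + of_int (-1) * t\<^sup>2" "W 1 0 (-1)" by (auto simp: W_def)
  then have B: "1 - t\<^sup>2 \<in> U" unfolding U_def by blast
  show thesis
  proof (rule that[OF dyadic_units_axioms])
    show "(t ^ 4 + 6 * t\<^sup>2 + 1)\<^sup>2 \<in> U" "(1 - t\<^sup>2)\<^sup>2 \<in> U"
      using A B by (simp_all add: power2_eq_square U_mult)
    show "2 \<in> quadratic_span \<int> t" using R_int[of 2] by simp
  qed auto
next
  case False
  have "t \<noteq> 0" using t False by auto
  \<comment> \<open>For odd \<open>n\<close> the number \<open>t\<close> is not integral above 2,
    whereas \<open>n / t\<close> is a root of the monic integral cubic
    \<open>X^3 - 2 X^2 - 2 n^2\<close>.\<close>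
  define \<theta> where "\<theta> = real n / t"
  have t\<theta>: "t * \<theta> = real n" using \<open>t \<noteq> 0\<close> by (simp add: \<theta>_def)
  have "\<theta> \<noteq> 0" using t\<theta> False by (auto simp: odd_pos)
  have t_eq: "t = real n / \<theta>" using t\<theta> \<open>\<theta> \<noteq> 0\<close> by (simp add: field_simps)
  have cube: "s ^ 3 = 2 * s\<^sup>2 + 2 * (real n)\<^sup>2 \<longleftrightarrow> real n = 2 * (real n / s) ^ 3 + 2 * (real n / s)" if "s \<noteq> 0" for s
  proof -
    have "real n = 2 * (real n / s) ^ 3 + 2 * (real n / s) \<longleftrightarrow> real n * s ^ 3 = real n * (2 * s\<^sup>2 + 2 * (real n)\<^sup>2)"
      using that by (simp add: field_simps power2_eq_square power3_eq_cube)
    then show ?thesis using False by (auto simp: odd_pos)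
  qed
  have \<theta>3: "\<theta> ^ 3 = 2 * \<theta>\<^sup>2 + 2 * (real n)\<^sup>2"
    unfolding cube[OF \<open>\<theta> \<noteq> 0\<close>] using t t_eq by simp
  interpret irreducible_cubic \<theta> 2 0 "2 * (real n)\<^sup>2"
  proof
    show "\<theta> ^ 3 = 2 * \<theta>\<^sup>2 + 0 * \<theta> + 2 * (real n)\<^sup>2" using \<theta>3 by simp
    fix s :: real assume s: "s \<in> \<rat>"
    show "s ^ 3 \<noteq> 2 * s\<^sup>2 + 0 * s + 2 * (real n)\<^sup>2"
    proof (cases "s = 0")
      case True
      then show ?thesis using False by (auto simp: odd_pos)
    next
      case s0: False
      have "real n / s \<in> \<rat>" using s by simp
      then show ?thesis using no_rational_parameter[OF _ n, of "real n / s"] cube[OF s0] by auto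
    qed
  qed auto
  \<comment> \<open>The cubic of \<theta> is Eisenstein at 2, so \<theta> lies in the only prime
    above 2, and reduction modulo that prime is the parity of the constant coefficient.\<close>
  define W :: "int \<Rightarrow> int \<Rightarrow> int \<Rightarrow> bool" where "W a b c \<longleftrightarrow> odd a" for a b c
  define U where "U = {of_int a + of_int b * \<theta> + of_int c * \<theta>\<^sup>2 | a b c. W a b c}"
  interpret dyadic_units "quadratic_span \<int> \<theta>" U
    unfolding U_def
    by (rule dyadic_unitsI[where p' = 2 and q' = 0 and r' = "2 * (int n)\<^sup>2"]) (auto simp: W_def)
  have "real n ^ 4 + 6 * (real n)\<^sup>2 * \<theta>\<^sup>2 + \<theta> ^ 4 =
      of_int (int n ^ 4 + 4 * (int n)\<^sup>2) + of_int (2 * (int n)\<^sup>2) * \<theta> + of_int (6 * (int n)\<^sup>2 + 4) * \<theta>\<^sup>2"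
    using \<theta>3 by simp Groebner_Basis.algebra
  moreover have "W (int n ^ 4 + 4 * (int n)\<^sup>2) (2 * (int n)\<^sup>2) (6 * (int n)\<^sup>2 + 4)"
    using False by (simp add: W_def)
  ultimately have A: "real n ^ 4 + 6 * (real n)\<^sup>2 * \<theta>\<^sup>2 + \<theta> ^ 4 \<in> U" unfolding U_def by blast
  have "\<theta>\<^sup>2 - (real n)\<^sup>2 = of_int (- (int n)\<^sup>2) + of_int 0 * \<theta> + of_int 1 * \<theta>\<^sup>2" "W (- (int n)\<^sup>2) 0 1"
    using False by (auto simp: W_def)
  then have B: "\<theta>\<^sup>2 - (real n)\<^sup>2 \<in> U" unfolding U_def by blast
  have "0 + 1 * \<theta> + 0 * \<theta>\<^sup>2 \<in> quadratic_span \<int> \<theta>"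
    unfolding quadratic_span_def by (intro CollectI exI conjI, rule refl) auto
  then have \<theta>R: "\<theta> \<in> quadratic_span \<int> \<theta>" by simp
  show thesis
  proof (rule that[OF dyadic_units_axioms])
    show "(real n ^ 4 + 6 * (real n)\<^sup>2 * \<theta>\<^sup>2 + \<theta> ^ 4)\<^sup>2 \<in> U" "(\<theta>\<^sup>2 - (real n)\<^sup>2)\<^sup>2 \<in> U"
      using A B by (simp_all add: power2_eq_square U_mult)
    \<comment> \<open>Powers of \<theta> are not in \<open>U\<close>, so those left after clearing
      denominators go into \<open>E\<close>.\<close>
    show "2 * \<theta> ^ 4 \<in> quadratic_span \<int> \<theta>" using R_int[of 2] \<theta>R by (auto intro!: R_mult R_power)
    have "t ^ 4 + 6 * t\<^sup>2 + 1 = (real n ^ 4 + 6 * (real n)\<^sup>2 * \<theta>\<^sup>2 + \<theta> ^ 4) / \<theta> ^ 4"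
      unfolding t_eq using \<open>\<theta> \<noteq> 0\<close> by (simp add: field_simps power2_eq_square power4_eq_xxxx)
    moreover have "1 - t\<^sup>2 = (\<theta>\<^sup>2 - (real n)\<^sup>2) / \<theta>\<^sup>2"
      unfolding t_eq using \<open>\<theta> \<noteq> 0\<close> by (simp add: field_simps)
    ultimately show "(t ^ 4 + 6 * t\<^sup>2 + 1)\<^sup>2 / (4 * (1 - t\<^sup>2)\<^sup>2) =
      (real n ^ 4 + 6 * (real n)\<^sup>2 * \<theta>\<^sup>2 + \<theta> ^ 4)\<^sup>2 / (2 * (2 * \<theta> ^ 4) * (\<theta>\<^sup>2 - (real n)\<^sup>2)\<^sup>2)"
      using \<open>\<theta> \<noteq> 0\<close> U_nonzero[OF B] by (simp add: power_divide) (simp add: field_simps)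
  qed (use \<open>\<theta> \<noteq> 0\<close> in auto)
qed

section \<open>The congruent number curve\<close>

text \<open>The cubic says \<open>8 * l * (1 - 2 * l)\<^sup>2 = - (real n)\<^sup>2\<close>, so
  \<open>- 2 * l\<close> is the square of \<open>t\<close>. Substituting this into
  \<open>n = 2 * t * (1 - 2 * l)\<close> gives the equation for \<open>t\<close>.\<close>

lemma cubic_root_parametrization:
  assumes "n > 0" "cubic_root n l"
  defines "t \<equiv> real n / (2 * (1 - 2 * l))"
  shows "real n = 2 * t ^ 3 + 2 * t" "l = - t\<^sup>2 / 2"
proof -
  have eq: "8 * l * (1 - 2 * l)\<^sup>2 = - (real n)\<^sup>2"
    using assms(2) unfolding cubic_root_def by Groebner_Basis.algebra
  have nz: "1 - 2 * l \<noteq> 0"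
    using eq assms(1) by auto
  have tn: "t * (2 * (1 - 2 * l)) = real n"
    using nz by (simp add: t_def)
  have "4 * ((t\<^sup>2 + 2 * l) * (1 - 2 * l)\<^sup>2) = (t * (2 * (1 - 2 * l)))\<^sup>2 + 8 * l * (1 - 2 * l)\<^sup>2"
    by Groebner_Basis.algebra
  also have "\<dots> = 0"
    unfolding tn eq by simp
  finally have t2: "t\<^sup>2 + 2 * l = 0" using nz by simp
  then show "l = - t\<^sup>2 / 2" by simp
  show "real n = 2 * t ^ 3 + 2 * t" 
  proof -
    have "2 * l = - t\<^sup>2" using t2 by simp
    then show ?thesis
      unfolding tn[symmetric] by (simp add: power2_eq_square power3_eq_cube algebra_simps)
  qed
qed

text \<open>Both claims are transferred from \<open>t\<close>: a solution exists between 0 and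
  \<open>n\<close> by the intermediate value theorem, and it is unique because
  \<open>u^2 + u t + t^2 + 1\<close> is positive.\<close>

lemma cubic_root_ex1:
  assumes "n > 0"
  shows "\<exists>!l. cubic_root n l"
proof -
  have "\<exists>t\<ge>0. t \<le> real n \<and> 2 * t ^ 3 + 2 * t = real n"
    by (rule IVT') (auto intro!: continuous_intros)
  then obtain t where t: "real n = 2 * t ^ 3 + 2 * t" by metis
  have unique: "u = t" if "real n = 2 * u ^ 3 + 2 * u" for u
  proof -
    have "(u - t) * (u\<^sup>2 + u * t + t\<^sup>2 + 1) = 0"
      using t that by Groebner_Basis.algebra
    moreover have "u\<^sup>2 + u * t + t\<^sup>2 = (u + t / 2)\<^sup>2 + 3 / 4 * t\<^sup>2"
      by (simp add: power2_eq_square algebra_simps)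
    then have "u\<^sup>2 + u * t + t\<^sup>2 + 1 > 0"
      using zero_le_power2[of "u + t / 2"] zero_le_power2[of t] by linarith
    ultimately show ?thesis by simp
  qed
  show ?thesis
  proof
    define l where "l = - t\<^sup>2 / 2"
    have "t\<^sup>2 = - (2 * l)" by (simp add: l_def)
    then have "cubic_root n l"
      unfolding cubic_root_def t by Groebner_Basis.algebra
    then show "cubic_root n (- t\<^sup>2 / 2)" by (simp add: l_def)
  next
    fix l assume "cubic_root n l"
    from cubic_root_parametrization[OF assms this] unique show "l = - t\<^sup>2 / 2" by metis
  qed
qed

text \<open>A rational root would make the parameter \<open>n / (2 * (1 - 2 * s))\<close>
  rational.\<close>

lemma irreducible_cubic_root:
  assumes "n > 0" "\<not> 4 dvd n" "cubic_root n l"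
  shows "irreducible_cubic l 1 (- 1 / 4) (- (real n)\<^sup>2 / 32)"
proof
  show "l ^ 3 = 1 * l\<^sup>2 + - 1 / 4 * l + - (real n)\<^sup>2 / 32"
    using assms(3) by (simp add: cubic_root_def)
next
  fix s :: real assume s: "s \<in> \<rat>"
  show "s ^ 3 \<noteq> 1 * s\<^sup>2 + - 1 / 4 * s + - (real n)\<^sup>2 / 32"
  proof
    assume "s ^ 3 = 1 * s\<^sup>2 + - 1 / 4 * s + - (real n)\<^sup>2 / 32"
    then have "cubic_root n s" by (simp add: cubic_root_def)
    from cubic_root_parametrization(1)[OF assms(1) this] no_rational_parameter[OF _ assms(2)] s
    show False by (metis Rats_1 Rats_diff Rats_divide Rats_mult Rats_number_of Rats_of_nat)
  qed
qed auto

section \<open>The point attached to the parameter\<close>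

locale cubic_parameter =
  fixes t :: real and n :: nat
  assumes n_pos: "n > 0" and n_4: "\<not> 4 dvd n" and n_t: "real n = 2 * t ^ 3 + 2 * t"
begin

text \<open>Square roots of \<open>x\<close>, \<open>x - n\<close> and \<open>x + n\<close> at the point \<open>P\<^sub>\<lambda>\<close>.\<close>

definition \<alpha> where "\<alpha> = (t ^ 4 + 6 * t\<^sup>2 + 1) / (2 * (1 - t\<^sup>2))"
definition \<beta> where "\<beta> = (4 * t\<^sup>2 + 4 * t * (1 + t\<^sup>2) - (1 + t\<^sup>2)\<^sup>2) / (2 * (1 - t\<^sup>2))"
definition \<gamma> where "\<gamma> = (4 * t\<^sup>2 - 4 * t * (1 + t\<^sup>2) - (1 + t\<^sup>2)\<^sup>2) / (2 * (1 - t\<^sup>2))"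

lemma t_ne: "1 - t\<^sup>2 \<noteq> 0"
proof
  assume "1 - t\<^sup>2 = 0"
  then have "t = 1 \<or> t = -1" by (simp add: power2_eq_1_iff)
  then show False using no_rational_parameter[of t n] n_4 n_t by auto
qed

lemma square_minus: "\<beta>\<^sup>2 = \<alpha>\<^sup>2 - real n" and square_plus: "\<gamma>\<^sup>2 = \<alpha>\<^sup>2 + real n"
proof -
  have "(4 * t\<^sup>2 + 4 * t * (1 + t\<^sup>2) - (1 + t\<^sup>2)\<^sup>2)\<^sup>2 = (t ^ 4 + 6 * t\<^sup>2 + 1)\<^sup>2 - real n * (2 * (1 - t\<^sup>2))\<^sup>2"
    "(4 * t\<^sup>2 - 4 * t * (1 + t\<^sup>2) - (1 + t\<^sup>2)\<^sup>2)\<^sup>2 = (t ^ 4 + 6 * t\<^sup>2 + 1)\<^sup>2 + real n * (2 * (1 - t\<^sup>2))\<^sup>2"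
    unfolding n_t by Groebner_Basis.algebra+
  then show "\<beta>\<^sup>2 = \<alpha>\<^sup>2 - real n" "\<gamma>\<^sup>2 = \<alpha>\<^sup>2 + real n"
    unfolding \<alpha>_def \<beta>_def \<gamma>_def power_divide using t_ne by (simp_all add: diff_divide_distrib add_divide_distrib)
qed

lemma x_coord_eq: "x_coord (real n) (- t\<^sup>2 / 2) = \<alpha>\<^sup>2"
  and y_coord_eq: "y_coord (real n) (- t\<^sup>2 / 2) = \<alpha> * \<beta> * \<gamma>"
proof -
  define l where "l = - t\<^sup>2 / 2"
  have t2: "t\<^sup>2 = - (2 * l)" by (simp add: l_def)
  \<comment> \<open>The cofactor of \<open>1 - t\<^sup>2\<close> in \<open>n^2 - 16\<close>, up to
    the constant -4. The numerators of \<open>x_coord\<close> and \<open>y_coord\<close> contain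
    \<open>w\<^sup>2\<close> and \<open>w ^ 3\<close>, which cancel.\<close>
  define w where "w = t ^ 4 + 3 * t\<^sup>2 + 4"
  define u where "u = 1 - t\<^sup>2"
  have "w > 0" by (simp add: w_def add_nonneg_pos)
  then have w: "w \<noteq> 0" by simp
  have u: "u \<noteq> 0" using t_ne by (simp add: u_def)
  have d: "real n ^ 2 - 16 = - (4 * u * w)"
    unfolding n_t u_def w_def by Groebner_Basis.algebra
  have X: "256 + 992 * real n ^ 2 + 65 * real n ^ 4 + (1024 - 2688 * real n ^ 2 - 28 * real n ^ 4) * l
      + (1024 + 1920 * real n ^ 2 + 4 * real n ^ 4) * l ^ 2 = 16 * (t ^ 4 + 6 * t\<^sup>2 + 1)\<^sup>2 * w\<^sup>2"
    unfolding n_t w_def using t2 by Groebner_Basis.algebra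
  show "x_coord (real n) (- t\<^sup>2 / 2) = \<alpha>\<^sup>2"
    unfolding x_coord_def l_def[symmetric] X d \<alpha>_def u_def[symmetric] using u w
    by (simp add: power_divide power_mult_distrib)
  have Y: "- 16384 + 72704 * real n ^ 2 + 80960 * real n ^ 4 + 2868 * real n ^ 6 - real n ^ 8
      + (196608 - 462848 * real n ^ 2 - 145152 * real n ^ 4 - 1456 * real n ^ 6) * l
      + (196608 + 421888 * real n ^ 2 + 100608 * real n ^ 4 + 208 * real n ^ 6) * l ^ 2 =
      - (256 * ((t ^ 4 + 6 * t\<^sup>2 + 1) * (4 * t\<^sup>2 + 4 * t * (1 + t\<^sup>2) - (1 + t\<^sup>2)\<^sup>2) * (4 * t\<^sup>2 - 4 * t * (1 + t\<^sup>2) - (1 + t\<^sup>2)\<^sup>2)) * w ^ 3)"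
    unfolding n_t w_def using t2 by Groebner_Basis.algebra
  show "y_coord (real n) (- t\<^sup>2 / 2) = \<alpha> * \<beta> * \<gamma>"
    unfolding y_coord_def l_def[symmetric] Y d \<alpha>_def \<beta>_def \<gamma>_def u_def[symmetric] using u w
    by (simp add: power_divide power_mult_distrib power3_eq_cube)
qed

lemma on_curve: "(\<alpha> * \<beta> * \<gamma>)\<^sup>2 = (\<alpha>\<^sup>2) ^ 3 - (real n)\<^sup>2 * \<alpha>\<^sup>2"
proof -
  have "a * (a - N) * (a + N) = a ^ 3 - N\<^sup>2 * a" for a N :: real
    by Groebner_Basis.algebra
  then show ?thesis
    by (simp only: power_mult_distrib square_plus square_minus)
qed

lemma point_doublings:
  assumes K: "subfield K real_ring" "\<alpha>\<^sup>2 \<in> K" "\<alpha> * \<beta> * \<gamma> \<in> K"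
  obtains f where "inj (fst \<circ> f)"
    "\<And>k. ((\<lambda>Q. ec_add (- (real n)\<^sup>2) Q Q) ^^ k) (Some (\<alpha>\<^sup>2, \<alpha> * \<beta> * \<gamma>)) = Some (f k)"
    "\<And>k. fst (f k) \<in> K \<and> snd (f k) \<in> K \<and> snd (f k) \<noteq> 0 \<and> (snd (f k))\<^sup>2 = fst (f k) ^ 3 - (real n)\<^sup>2 * fst (f k)"
proof -
  obtain R U A B E where "dyadic_units R U" and ABE: "A \<in> U" "B \<in> U" "E \<in> R" "E \<noteq> 0"
    "(t ^ 4 + 6 * t\<^sup>2 + 1)\<^sup>2 / (4 * (1 - t\<^sup>2)\<^sup>2) = A / (2 * E * B)"
    using dyadic_level[OF n_4 n_t] by metis
  interpret dyadic_units R U by fact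
  have x: "\<alpha>\<^sup>2 = A / (2 * E * B)"
    unfolding ABE(5)[symmetric] \<alpha>_def by (simp only: power_divide power_mult_distrib) simp
  have "real n \<in> K" using subfield_real_ringD(8)[OF K(1)] by auto
  moreover have "real n \<in> R" using R_int[of "int n"] by simp
  ultimately show thesis
    using doublings[OF on_curve ABE(1,2) x ABE(3,4) _ K(1) _ K(2,3)] that by blast
qed

lemma point_infinite_order:
  assumes K: "subfield K real_ring" "\<alpha>\<^sup>2 \<in> K" "\<alpha> * \<beta> * \<gamma> \<in> K"
  shows "infinite_order_in (congruent_curve n K) (Some (\<alpha>\<^sup>2, \<alpha> * \<beta> * \<gamma>))"
proof -
  define r where "r = sqrt (real n)"
  have r: "r\<^sup>2 = real n" "r \<noteq> 0" using n_pos by (auto simp: r_def)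
  have "\<gamma>\<^sup>2 > 0" unfolding square_plus using n_pos by (simp add: add_nonneg_pos)
  then have \<gamma>: "\<gamma> \<noteq> 0" by auto
  \<comment> \<open>Solved from the parametrisation with \<open>r\<^sup>2 = n\<close>: there
    \<open>x + n = r^2 / s^2\<close> is \<open>\<gamma>\<^sup>2\<close>, so
    \<open>s = r / \<gamma>\<close>, and \<beta>, \<alpha> as roots of \<open>x - n\<close> and
    \<open>x\<close> give \<open>c\<close> and \<open>d\<close>.\<close>
  define p where "p = (r / \<gamma>, \<beta> / \<gamma>, \<alpha> / \<gamma>)"
  have p: "p \<in> jacobi_curve"
  proof -
    have "\<beta>\<^sup>2 = \<gamma>\<^sup>2 - 2 * r\<^sup>2" "\<alpha>\<^sup>2 = \<gamma>\<^sup>2 - r\<^sup>2"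
      using square_plus square_minus r(1) by simp_all
    then show ?thesis
      using \<gamma> by (simp add: p_def jacobi_curve_def power_divide diff_divide_distrib)
  qed
  have "r\<^sup>2 * (1 / (r / \<gamma>)\<^sup>2 - 1) = \<gamma>\<^sup>2 - r\<^sup>2"
    using r(2) by (simp add: power_divide right_diff_distrib)
  then have px: "r\<^sup>2 * (1 / (r / \<gamma>)\<^sup>2 - 1) = \<alpha>\<^sup>2" by (simp add: square_plus r(1))
  have py: "r ^ 3 * (\<beta> / \<gamma> * (\<alpha> / \<gamma>)) / (r / \<gamma>) ^ 3 = \<alpha> * \<beta> * \<gamma>"
    using r(2) \<gamma> by (simp add: power_divide power3_eq_cube)
  have P: "jacobi_to_ec r p = Some (\<alpha>\<^sup>2, \<alpha> * \<beta> * \<gamma>)"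
    unfolding p_def jacobi_to_ec.simps px py using r(2) \<gamma> by simp
  obtain f :: "nat \<Rightarrow> real \<times> real" where f: "inj (fst \<circ> f)"
    "\<And>k. ((\<lambda>Q. ec_add (- (real n)\<^sup>2) Q Q) ^^ k) (Some (\<alpha>\<^sup>2, \<alpha> * \<beta> * \<gamma>)) = Some (f k)"
    using point_doublings[OF K] by metis
  have "inj (\<lambda>k. Some (f k))"
    using f(1) by (auto simp: inj_on_def)
  then have "inj (\<lambda>k. ((\<lambda>Q. ec_add (- (r\<^sup>2)\<^sup>2) Q Q) ^^ k) (jacobi_to_ec r p))"
    unfolding P r(1) f(2) .
  from power_ne_one_if_doublings_distinct[OF p r(2) this, of _ K 0]
  have "Some (\<alpha>\<^sup>2, \<alpha> * \<beta> * \<gamma>) [^]\<^bsub>congruent_curve n K\<^esub> m \<noteq> \<one>\<^bsub>congruent_curve n K\<^esub>" if "m > 0" for m :: nat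
    using that unfolding P r(1) congruent_curve_def by simp
  moreover have "Some (\<alpha>\<^sup>2, \<alpha> * \<beta> * \<gamma>) \<in> carrier (congruent_curve n K)"
    using K on_curve by (simp add: congruent_curve_def ec_group_def)
  ultimately show ?thesis
    unfolding infinite_order_in_def by blast
qed

lemma infinitely_many_triangles:
  assumes K: "subfield K real_ring" "\<alpha>\<^sup>2 \<in> K" "\<alpha> * \<beta> * \<gamma> \<in> K"
  shows "infinite (congruent_solutions K n)"
proof -
  obtain f :: "nat \<Rightarrow> real \<times> real" where f: "inj (fst \<circ> f)"
    "\<And>k. ((\<lambda>Q. ec_add (- (real n)\<^sup>2) Q Q) ^^ k) (Some (\<alpha>\<^sup>2, \<alpha> * \<beta> * \<gamma>)) = Some (f k)"
    "\<And>k. fst (f k) \<in> K \<and> snd (f k) \<in> K \<and> snd (f k) \<noteq> 0 \<and> (snd (f k))\<^sup>2 = fst (f k) ^ 3 - (real n)\<^sup>2 * fst (f k)"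
    by (rule point_doublings[OF K]) blast
  define N where "N = real n"
  have N: "N \<noteq> 0" "N \<in> K" using n_pos subfield_real_ringD(8)[OF K(1)] by (auto simp: N_def)
  note KD = subfield_real_ringD[OF K(1)]
  have num: "numeral i \<in> K" for i using KD(8) by auto
  \<comment> \<open>The classical map from points of the curve to right triangles of area
    \<open>N\<close>; \<open>ratio\<close> recovers the abscissa, so distinct abscissas give
    distinct triangles.\<close>
  define T where "T = (\<lambda>(x, y). ((x\<^sup>2 - N\<^sup>2) / y, 2 * N * x / y, (x\<^sup>2 + N\<^sup>2) / y))"
  define ratio where "ratio = (\<lambda>(a, b, c). (a + c) / b * N)"
  have xy: "ratio (T (x, y)) = x \<and> T (x, y) \<in> congruent_solutions K n"
    if xy: "x \<in> K" "y \<in> K" "y \<noteq> 0" "y\<^sup>2 = x ^ 3 - N\<^sup>2 * x" for x y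
  proof
    have "x \<noteq> 0" using xy by auto
    then show "ratio (T (x, y)) = x"
      using N xy(3) by (simp add: ratio_def T_def field_simps power2_eq_square)
    have "(x\<^sup>2 - N\<^sup>2)\<^sup>2 + (2 * N * x)\<^sup>2 = (x\<^sup>2 + N\<^sup>2)\<^sup>2" by Groebner_Basis.algebra
    then have "((x\<^sup>2 - N\<^sup>2) / y)\<^sup>2 + (2 * N * x / y)\<^sup>2 = ((x\<^sup>2 + N\<^sup>2) / y)\<^sup>2"
      by (simp add: power_divide flip: add_divide_distrib)
    moreover have "(x\<^sup>2 - N\<^sup>2) * (N * x) = N * y\<^sup>2" using xy(4) by Groebner_Basis.algebra
    then have "1 / 2 * ((x\<^sup>2 - N\<^sup>2) / y) * (2 * N * x / y) = N"
      using xy(3) by (simp add: field_simps power2_eq_square)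
    moreover have "(x\<^sup>2 - N\<^sup>2) / y \<in> K" "2 * N * x / y \<in> K" "(x\<^sup>2 + N\<^sup>2) / y \<in> K"
      by (intro KD(2-7) xy N num)+
    ultimately show "T (x, y) \<in> congruent_solutions K n"
      unfolding T_def congruent_solutions_def N_def by (simp only: prod.case mem_Collect_eq simp_thms)
  qed
  have Tf: "ratio (T (f k)) = (fst \<circ> f) k" "T (f k) \<in> congruent_solutions K n" for k
    using xy[of "fst (f k)" "snd (f k)"] f(3)[of k] by (simp_all add: N_def)
  have "inj (T \<circ> f)"
    using f(1) Tf(1) by (metis comp_apply injD injI)
  then have "infinite (range (T \<circ> f))"
    using range_inj_infinite by blast
  moreover have "range (T \<circ> f) \<subseteq> congruent_solutions K n"
    using Tf(2) by auto
  ultimately show ?thesis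
    using finite_subset by blast
qed

end

lemma coords_mem:
  assumes K: "subfield K real_ring" "l \<in> K"
  shows "x_coord (real n) l \<in> K" "y_coord (real n) l \<in> K"
proof -
  note KD = subfield_real_ringD[OF K(1)]
  have num: "numeral i \<in> K" "real n \<in> K" for i using KD(8) by auto
  show "x_coord (real n) l \<in> K" "y_coord (real n) l \<in> K"
    unfolding x_coord_def y_coord_def by (intro KD(1-7) K num)+
qed

lemma cubic_root_field:
  assumes n: "n > 0" "\<not> 4 dvd n" and l: "cubic_root n l"
  shows "real_cubic_field (rat_adjoin l)"
    and "infinite_order_in (congruent_curve n (rat_adjoin l)) (Some (x_coord (real n) l, y_coord (real n) l))"
    and "infinite (congruent_solutions (rat_adjoin l) n)"
proof -
  interpret irreducible_cubic l 1 "- 1 / 4" "- (real n)\<^sup>2 / 32"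
    by (rule irreducible_cubic_root[OF n l])
  show "real_cubic_field (rat_adjoin l)" by (rule rat_adjoin_cubic)
  then have K: "subfield (rat_adjoin l) real_ring" by (simp add: real_cubic_field_def)
  have "l \<in> rat_adjoin l" unfolding rat_adjoin_def by (rule generate_field.incl) simp
  note mem = coords_mem[OF K this, of n]
  obtain t where t: "real n = 2 * t ^ 3 + 2 * t" "l = - t\<^sup>2 / 2"
    using cubic_root_parametrization[OF n(1) l] by blast
  interpret cubic_parameter t n
    using n t(1) by unfold_locales
  show "infinite_order_in (congruent_curve n (rat_adjoin l)) (Some (x_coord (real n) l, y_coord (real n) l))"
    using point_infinite_order[OF K] mem unfolding t(2) x_coord_eq y_coord_eq by blast
  show "infinite (congruent_solutions (rat_adjoin l) n)"
    using infinitely_many_triangles[OF K] mem unfolding t(2) x_coord_eq y_coord_eq by blast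
qed

section \<open>All positive integers: removing factors of 4\<close>

lemma properly_congruent_over_iff:
  "properly_congruent_over K n \<longleftrightarrow> infinite (congruent_solutions K n)"
proof -
  have "congruent_over K n" if inf: "infinite (congruent_solutions K n)"
  proof -
    obtain p where "p \<in> congruent_solutions K n"
      using infinite_imp_nonempty[OF inf] by blast
    then show ?thesis by (auto simp: congruent_solutions_def congruent_over_def)
  qed
  then show ?thesis by (auto simp: properly_congruent_over_def)
qed

text \<open>Doubling the sides of a triangle multiplies its area by 4.\<close>

lemma infinite_congruent_solutions_scale:
  assumes K: "subfield K real_ring" and inf: "infinite (congruent_solutions K n)"
  shows "infinite (congruent_solutions K (4 * n))"
proof -
  define g :: "real \<times> real \<times> real \<Rightarrow> real \<times> real \<times> real"
    where "g = (\<lambda>(a, b, c). (2 * a, 2 * b, 2 * c))"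
  have "inj g" by (auto simp: g_def inj_def)
  then have "infinite (g ` congruent_solutions K n)"
    using inf finite_imageD inj_on_subset by blast
  moreover have "2 \<in> K" using subfield_real_ringD(8)[OF K] by auto
  then have "g ` congruent_solutions K n \<subseteq> congruent_solutions K (4 * n)"
    by (auto simp: g_def congruent_solutions_def power_mult_distrib subfield_real_ringD[OF K])
  ultimately show ?thesis using finite_subset by blast
qed

text \<open>Strong induction strips factors of 4 while keeping the field. Once 4 does not divide
  \<open>n\<close>, the field of the root of its own cubic serves.\<close>

lemma properly_congruent_over_cubic_field:
  assumes "n > 0"
  shows "\<exists>K. real_cubic_field K \<and> properly_congruent_over K n"
  using assms
proof (induction n rule: less_induct)
  case (less n)
  show ?case
  proof (cases "4 dvd n")
    case True
    then obtain m where m: "n = 4 * m" by auto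
    then obtain K where K: "real_cubic_field K" "infinite (congruent_solutions K m)"
      using less.IH[of m] less.prems by (auto simp: properly_congruent_over_iff)
    then show ?thesis
      using infinite_congruent_solutions_scale unfolding m
      by (auto simp: properly_congruent_over_iff real_cubic_field_def)
  next
    case False
    then show ?thesis
      using cubic_root_field[OF less.prems False] cubic_root_ex1[OF less.prems]
      by (auto simp: properly_congruent_over_iff)
  qed
qed

lemma squarefree_not_4_dvd:
  assumes "squarefree (n::nat)"
  shows "\<not> 4 dvd n"
  using assms squarefreeD[of n 2] by auto

theorem theorem3:
  shows "(\<forall>n::nat. n > 0 \<longrightarrow>
            (\<exists>K::real set. real_cubic_field K \<and> properly_congruent_over K n)) \<and>
         (\<forall>n::nat. n > 0 \<longrightarrow> squarefree n \<longrightarrow>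
            (\<exists>!l::real. cubic_root n l) \<and>
            (\<forall>l::real. cubic_root n l \<longrightarrow>
               real_cubic_field (rat_adjoin l) \<and>
               infinite_order_in (congruent_curve n (rat_adjoin l))
                 (Some (x_coord (real n) l, y_coord (real n) l))))"
  using properly_congruent_over_cubic_field cubic_root_ex1
    cubic_root_field(1,2)[OF _ squarefree_not_4_dvd]
  by simp

end
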